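(* Let $G=(V,E,w)$ be a finite connected weighted semi-bipartite graph with parts $V_1$ and $V_2$, and let $P=\{p_1,\dots,p_k\}\subseteq V_1$. Assume: 1. $|V_1|=|V_2|+1$; 2. at least one of the following holds: (2a) $\det(A_{G-p_j})\neq 0$ for all $j=1,\dots,k$; (2b) $A_G$ has a unique (up to scaling) eigenvector with eigenvalue $0$, and this eigenvector has non-zero amplitude on each $p_j$. Let $a,b\in P$, let $T>0$, and let $f_v:[0,T]\to\mathbb{C}$ ($v\in V_1$) be continuous functions such that - $f_a(0)=0$; - $f_b(T)=0$; - $f_v(t)\neq 0$ for all $v\in V_1\setminus P$ and all $t\in[0,T]$; - for every $t\in[0,T]$, at most one $v\in V_1$ satisfies $f_v(t)=0$. Let $H_G(t)$, $t\in[0,T]$, be the control Hamiltonian of $G$ with the commensurate couplings given by the $f_v$. Then $H_G(t)$ has a unique, continuously changing zero eigenstate, which is localized at $a$ at $t=0$ and at $b$ at $t=T$. That is, for every $t\in[0,T]$ the kernel of $H_G(t)$ is one-dimensional, this one-dimensional subspace depends continuously on $t$, it is spanned by $|a\rangle$ at $t=0$, and it is spanned by $|b\rangle$ at $t=T$. Moreover, $H_G$ adiabatically transfers amplitude from $a$ to $b$ (in the sense defined in the context, where the $f_v$ are assumed to depend smoothly on $t$).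
   Context: **Weighted graphs.** A finite weighted graph $G=(V,E,w)$ has weights $w_{uv}\in\mathbb{C}$ with $w_{uv}=\overline{w_{vu}}$ and $w_{uv}=0$ whenever $uv\notin E$. Self-loops are allowed where stated. The adjacency matrix $A_G$ is the Hermitian matrix, indexed by $V$, with entries $(A_G)_{uv}=w_{uv}$. It acts on $\mathcal V=\mathbb{C}^V$ with orthonormal basis $\{|v\rangle\}_{v\in V}$. The amplitude of a vector on $v$ is its $v$-component. $G-v$ denotes $G$ with the vertex $v$ and all its incident edges removed (the determinant of an empty matrix is $1$). **Semi-bipartite.** $G$ is semi-bipartite with parts $V_1,V_2$ if $V=V_1\sqcup V_2$ and there are no edges (including self-loops) within $V_1$. Edges between $V_1$ and $V_2$, and edges and self-loops within $V_2$, are allowed. The decomposition is part of the data. **Control Hamiltonian and commensurate couplings.** In general the control Hamiltonian is $H_G(t)=\sum_{u,v\in V} f_{uv}(t)\,w_{uv}\,|u\rangle\langle v|$ with continuous controls satisfying $f_{uv}(t)=\overline{f_{vu}(t)}$. Commensurate couplings given by functions $f_v$ ($v\in V_1$) means $f_{vu}(t)=f_v(t)$ for all $v\in V_1$, $u\in V_2$, and $f_{uv}(t)=1$ for all $u,v\in V_2$. Equivalently, $H_G(t)=F(t)A_GF(t)^*$, where $F(t)$ is the diagonal matrix with entry $f_v(t)$ at $v\in V_1$ and entry $1$ at each vertex of $V_2$. **Adiabatic transfer.** Suppose $t\mapsto H_G(t)$, $t\in[0,T]$, is smooth. For $\tau>0$, let $\psi_\tau:[0,\tau]\to\mathcal V$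 be the solution of the Schrödinger equation with the time-rescaled Hamiltonian, $$i\hbar\,\frac{d}{dt}\psi_\tau(t)=H_G(tT/\tau)\,\psi_\tau(t),\qquad \psi_\tau(0)=|a\rangle,$$ where $\hbar>0$ is a constant. We say that $H_G$ adiabatically transfers amplitude from $a$ to $b$ if $|\langle b|\psi_\tau(\tau)\rangle|\to 1$ as $\tau\to\infty$. *)

theory Defs
  imports "HOL-Analysis.Analysis"
begin

text \<open>The vertex set of a graph is the (nonempty, finite) type \<open>'v\<close>; the state space is
  \<open>complex ^ 'v\<close> and the basis vector at a vertex \<open>v\<close> is \<open>axis v 1\<close>. Edges are given as a symmetric
  relation, a self-loop at \<open>v\<close> being the pair \<open>(v, v)\<close>.\<close>

definition weighted_graph :: "('v \<times> 'v) set \<Rightarrow> ('v \<Rightarrow> 'v \<Rightarrow> complex) \<Rightarrow> bool" where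
  "weighted_graph E w \<longleftrightarrow>
     sym E \<and> (\<forall>u v. w u v = cnj (w v u)) \<and> (\<forall>u v. (u, v) \<notin> E \<longrightarrow> w u v = 0)"

definition connected_graph :: "('v \<times> 'v) set \<Rightarrow> bool" where
  "connected_graph E \<longleftrightarrow> (\<forall>u v. (u, v) \<in> E\<^sup>*)"

definition semi_bipartite :: "('v \<times> 'v) set \<Rightarrow> 'v set \<Rightarrow> 'v set \<Rightarrow> bool" where
  "semi_bipartite E V1 V2 \<longleftrightarrow>
     V1 \<union> V2 = UNIV \<and> V1 \<inter> V2 = {} \<and> (\<forall>u\<in>V1. \<forall>v\<in>V1. (u, v) \<notin> E)"

definition adjacency :: "('v \<Rightarrow> 'v \<Rightarrow> complex) \<Rightarrow> complex ^ 'v ^ 'v" where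
  "adjacency w = (\<chi> u v. w u v)"

text \<open>Determinant of the submatrix of \<open>A\<close> whose rows and columns are indexed by \<open>S\<close>. The adjacency
  matrix of \<open>G - v\<close> is the submatrix of that of \<open>G\<close> indexed by \<open>UNIV - {v}\<close>.\<close>

definition principal_det :: "'v set \<Rightarrow> 'a::comm_ring_1 ^ 'v ^ 'v \<Rightarrow> 'a" where
  "principal_det S A = (\<Sum>p | p permutes S. of_int (sign p) * (\<Prod>i\<in>S. A $ i $ p i))"

lemma principal_det_UNIV: "principal_det UNIV A = det A"
  by (simp add: principal_det_def det_def)

lemma principal_det_empty: "principal_det {} A = 1"
  by (simp add: principal_det_def)

definition det_delete_vertex :: "('v \<Rightarrow> 'v \<Rightarrow> complex) \<Rightarrow> 'v::finite \<Rightarrow> complex" where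
  "det_delete_vertex w v = principal_det (UNIV - {v}) (adjacency w)"

definition matrix_kernel :: "complex ^ 'v ^ 'v \<Rightarrow> (complex ^ 'v) set" where
  "matrix_kernel A = {x. A *v x = 0}"

definition control_hamiltonian ::
    "('v \<Rightarrow> 'v \<Rightarrow> complex) \<Rightarrow> ('v \<Rightarrow> 'v \<Rightarrow> real \<Rightarrow> complex) \<Rightarrow> real \<Rightarrow> complex ^ 'v ^ 'v" where
  "control_hamiltonian w c t = (\<chi> u v. c u v t * w u v)"

text \<open>The controls within \<open>V1\<close> are irrelevant, since there are no edges there; they are set so that the
  Hamiltonian is \<open>F(t) A F(t)\<^sup>*\<close> for every \<open>w\<close>.\<close>

definition commensurate_couplings ::
    "'v set \<Rightarrow> ('v \<Rightarrow> real \<Rightarrow> complex) \<Rightarrow> 'v \<Rightarrow> 'v \<Rightarrow> real \<Rightarrow> complex" where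
  "commensurate_couplings V1 f u v t =
     (if u \<in> V1 then f u t else 1) * cnj (if v \<in> V1 then f v t else 1)"

lemma commensurate_couplings_cnj:
  "commensurate_couplings V1 f u v t = cnj (commensurate_couplings V1 f v u t)"
  by (simp add: commensurate_couplings_def)

lemma commensurate_couplings_V1_V2:
  "v \<in> V1 \<Longrightarrow> u \<notin> V1 \<Longrightarrow> commensurate_couplings V1 f v u t = f v t"
  by (simp add: commensurate_couplings_def)

lemma commensurate_couplings_V2_V2:
  "u \<notin> V1 \<Longrightarrow> v \<notin> V1 \<Longrightarrow> commensurate_couplings V1 f u v t = 1"
  by (simp add: commensurate_couplings_def)

definition coupling_matrix :: "'v set \<Rightarrow> ('v \<Rightarrow> real \<Rightarrow> complex) \<Rightarrow> real \<Rightarrow> complex ^ 'v ^ 'v" where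
  "coupling_matrix V1 f t = (\<chi> u v. if u = v then (if u \<in> V1 then f u t else 1) else 0)"

lemma control_hamiltonian_commensurate:
  "control_hamiltonian w (commensurate_couplings V1 f) t =
     coupling_matrix V1 f t ** adjacency w ** (\<chi> u v. cnj (coupling_matrix V1 f t $ v $ u))"
proof -
  define d where "d v = (if v \<in> V1 then f v t else 1)" for v
  have diag: "coupling_matrix V1 f t $ u $ v = (if u = v then d u else 0)" for u v
    by (simp add: coupling_matrix_def d_def)
  have "(\<Sum>k\<in>UNIV. (\<Sum>l\<in>UNIV. (if u = l then d u else 0) * w l k) * cnj (if v = k then d v else 0))
        = d u * w u v * cnj (d v)" for u v
  proof -
    have "(\<Sum>l\<in>UNIV. (if u = l then d u else 0) * w l k) = d u * w u k" for k
      by (subst sum.remove[of _ u]) (auto intro!: sum.neutral)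
    then show ?thesis
      by (simp only:) (subst sum.remove[of _ v], auto intro!: sum.neutral)
  qed
  then show ?thesis
    by (simp add: vec_eq_iff matrix_matrix_mult_def control_hamiltonian_def adjacency_def diag
        commensurate_couplings_def d_def[symmetric] mult_ac)
qed

text \<open>For a closed linear subspace, \<^const>\<open>closest_point\<close> is the orthogonal projection (for a complex
  subspace it makes no difference whether orthogonality is real or Hermitian). So this is continuity
  in the usual topology on the set of subspaces, given by the orthogonal projectors.\<close>

definition continuous_subspace_on :: "real set \<Rightarrow> (real \<Rightarrow> (complex ^ 'v) set) \<Rightarrow> bool" where
  "continuous_subspace_on I S \<longleftrightarrow> (\<forall>x. continuous_on I (\<lambda>t. closest_point (S t) x))"

text \<open>Infinite differentiability, with one-sided derivatives at the end points of an interval;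
  \<open>g n\<close> is the \<open>n\<close>-th derivative.\<close>

definition smooth_on :: "real set \<Rightarrow> (real \<Rightarrow> 'a::real_normed_vector) \<Rightarrow> bool" where
  "smooth_on I f \<longleftrightarrow>
     (\<exists>g. (\<forall>t\<in>I. g 0 t = f t) \<and>
          (\<forall>n. \<forall>t\<in>I. (g n has_vector_derivative g (Suc n) t) (at t within I)))"

definition schroedinger_solution ::
    "real \<Rightarrow> real \<Rightarrow> (real \<Rightarrow> complex ^ 'v ^ 'v) \<Rightarrow> 'v::finite \<Rightarrow> real \<Rightarrow> (real \<Rightarrow> complex ^ 'v) \<Rightarrow> bool"
where
  "schroedinger_solution hbar T H a \<tau> \<psi> \<longleftrightarrow>
     \<psi> 0 = axis a 1 \<and>
     (\<forall>t\<in>{0..\<tau>}. \<exists>\<psi>'. (\<psi> has_vector_derivative \<psi>') (at t within {0..\<tau>}) \<and>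
        (\<i> * complex_of_real hbar) *s \<psi>' = H (t * T / \<tau>) *v \<psi> t)"

text \<open>The solution on \<open>{0..\<tau>}\<close> is unique only up to its values outside the interval, so instead of
  choosing one we require that it exists and that the limit holds for every choice.\<close>

definition adiabatically_transfers ::
    "real \<Rightarrow> real \<Rightarrow> (real \<Rightarrow> complex ^ 'v ^ 'v) \<Rightarrow> 'v::finite \<Rightarrow> 'v \<Rightarrow> bool" where
  "adiabatically_transfers hbar T H a b \<longleftrightarrow>
     (\<forall>\<tau>>0. \<exists>\<psi>. schroedinger_solution hbar T H a \<tau> \<psi>) \<and>
     (\<forall>\<Psi>. (\<forall>\<tau>>0. schroedinger_solution hbar T H a \<tau> (\<Psi> \<tau>)) \<longrightarrow>
        ((\<lambda>\<tau>. cmod (\<Psi> \<tau> \<tau> $ b)) \<longlongrightarrow> 1) at_top)"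

end

theory Submission
  imports Defs
begin

text \<open>With \<open>d\<^sub>v(t) = f\<^sub>v(t)\<close> on \<open>V\<^sub>1\<close> and \<open>1\<close> on \<open>V\<^sub>2\<close>, the vector
  \<open>x\<^sub>v(t) = \<phi>\<^sub>v (\<Prod>u \<noteq> v. cnj (d\<^sub>u(t)))\<close> is annihilated by \<open>H(t) = F(t) A F(t)\<^sup>*\<close> when
  \<open>A \<phi> = 0\<close>, and it has no poles: clearing denominators in \<open>F\<^sup>*\<^sup>-\<^sup>1 \<phi>\<close> makes it continuous
  through the zeros of the couplings, where it concentrates at the decoupled vertex. As \<open>A\<close> is
  Hermitian, the kernel does not grow at these zeros.

  For the adiabatic limit the eigenvalue is constantly \<open>0\<close>, so with the parallel transported zero
  state \<open>e\<close> one has \<open>e' = H g\<close> for a differentiable \<open>g\<close>, and one integration by parts shows that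
  \<open>\<langle>e, \<psi>\<^sub>\<tau>\<rangle>\<close> changes by \<open>O(1/\<tau>)\<close> only.\<close>

section \<open>The Hermitian inner product\<close>

definition cinner :: "complex ^ 'n \<Rightarrow> complex ^ 'n \<Rightarrow> complex" where
  "cinner x y = (\<Sum>i\<in>UNIV. cnj (x $ i) * y $ i)"

lemma cinner_add_right: "cinner x (y + z) = cinner x y + cinner x z"
  by (simp add: cinner_def algebra_simps sum.distrib)

lemma cinner_diff_right: "cinner x (y - z) = cinner x y - cinner x z"
  by (simp add: cinner_def algebra_simps sum_subtractf)

lemma cinner_smult_right: "cinner x (c *s y) = c * cinner x y"
  by (simp add: cinner_def sum_distrib_left algebra_simps)

lemma cinner_smult_left: "cinner (c *s x) y = cnj c * cinner x y"
  by (simp add: cinner_def sum_distrib_left algebra_simps)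

lemma cinner_zero_left [simp]: "cinner 0 x = 0"
  by (simp add: cinner_def)

lemma cinner_zero_right [simp]: "cinner x 0 = 0"
  by (simp add: cinner_def)

lemma cinner_commute: "cinner x y = cnj (cinner y x)"
  by (simp add: cinner_def mult.commute)

lemma cinner_axis_left: "cinner (axis i c) y = cnj c * y $ i"
  by (subst cinner_def, subst sum.remove[of _ i]) (auto simp: axis_def)

lemma cinner_axis_right: "cinner x (axis i c) = cnj (x $ i) * c"
  by (subst cinner_def, subst sum.remove[of _ i]) (auto simp: axis_def)

lemma inner_eq_Re_cinner: "x \<bullet> y = Re (cinner x y)"
  by (simp add: inner_vec_def cinner_def inner_complex_def)

lemma cinner_self: "cinner x x = complex_of_real ((norm x)\<^sup>2)"
proof (rule complex_eqI)
  show "Re (cinner x x) = Re (complex_of_real ((norm x)\<^sup>2))"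
    by (simp flip: inner_eq_Re_cinner add: power2_norm_eq_inner)
  have "Im (cinner x x) = - Im (cinner x x)"
    using cinner_commute[of x x] by (metis cnj.sel(2))
  then show "Im (cinner x x) = Im (complex_of_real ((norm x)\<^sup>2))"
    by simp
qed

lemma cinner_self_eq_0_iff [simp]: "cinner x x = 0 \<longleftrightarrow> x = 0"
  by (simp add: cinner_self)

lemma norm_cinner_le: "cmod (cinner x y) \<le> norm x * norm y"
proof -
  have "cmod (cinner x y) \<le> (\<Sum>i\<in>UNIV. \<bar>cmod (x $ i)\<bar> * \<bar>cmod (y $ i)\<bar>)"
    unfolding cinner_def by (rule order_trans[OF norm_sum]) (simp add: norm_mult)
  also have "\<dots> \<le> norm x * norm y"
    unfolding norm_vec_def by (rule L2_set_mult_ineq)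
  finally show ?thesis .
qed

lemma norm_smult_vec: "norm (c *s (x :: complex ^ 'n)) = cmod c * norm x"
  by (simp add: norm_vec_def norm_mult L2_set_right_distrib)

section \<open>Hermitian matrices and orthogonal projection onto a complex line\<close>

definition hermitian :: "complex ^ 'n ^ 'n \<Rightarrow> bool" where
  "hermitian A \<longleftrightarrow> (\<forall>i j. A $ i $ j = cnj (A $ j $ i))"

lemma cinner_hermitian:
  assumes "hermitian A"
  shows "cinner x (A *v y) = cinner (A *v x) y"
proof -
  have "cinner x (A *v y) = (\<Sum>i\<in>UNIV. \<Sum>j\<in>UNIV. cnj (x $ i) * A $ i $ j * y $ j)"
    by (simp add: cinner_def matrix_vector_mult_def sum_distrib_left mult.assoc)
  also have "\<dots> = (\<Sum>j\<in>UNIV. \<Sum>i\<in>UNIV. cnj (A $ j $ i * x $ i) * y $ j)"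
  proof (subst sum.swap, intro sum.cong refl)
    fix i j
    have "A $ i $ j = cnj (A $ j $ i)"
      using assms unfolding hermitian_def by blast
    then show "cnj (x $ i) * A $ i $ j * y $ j = cnj (A $ j $ i * x $ i) * y $ j"
      by (simp only: complex_cnj_mult mult_ac)
  qed
  also have "\<dots> = cinner (A *v x) y"
    by (simp add: cinner_def matrix_vector_mult_def sum_distrib_right)
  finally show ?thesis .
qed

lemma scaleR_eq_smult: "r *\<^sub>R x = complex_of_real r *s x" for x :: "complex ^ 'n"
  by (rule vec_eq_iff[THEN iffD2], rule allI)
    (simp only: vector_scaleR_component vector_smult_component scaleR_conv_of_real[where 'a = complex])

text \<open>The residual \<open>y - cinner \<psi> y *s \<psi>\<close> is Hermitian-orthogonal to the
  whole line. It is therefore orthogonal for the real inner product too, and Pythagoras makes it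
  shortest. This formula reduces continuity of a line, as measured by \<open>closest_point\<close>,
  to continuity of a unit vector spanning it.\<close>

lemma closest_point_span_singleton:
  assumes "norm \<psi> = 1"
  shows "closest_point (vec.span {\<psi>}) y = cinner \<psi> y *s \<psi>"
proof (rule closest_point_unique[symmetric])
  have "subspace (vec.span {\<psi>})"
    by (simp add: subspace_def vec.span_zero vec.span_add vec.span_scale scaleR_eq_smult)
  then show "convex (vec.span {\<psi>})" "closed (vec.span {\<psi>})"
    by (simp_all add: subspace_imp_convex closed_subspace)
  show "cinner \<psi> y *s \<psi> \<in> vec.span {\<psi>}"
    by (simp add: vec.span_base vec.span_scale)
  show "\<forall>z\<in>vec.span {\<psi>}. dist y (cinner \<psi> y *s \<psi>) \<le> dist y z"
  proof
    fix z assume "z \<in> vec.span {\<psi>}"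
    then obtain c where z: "z = c *s \<psi>"
      by (auto simp: vec.span_singleton)
    let ?p = "cinner \<psi> y *s \<psi>"
    have "?p - z = (cinner \<psi> y - c) *s \<psi>"
      by (simp add: z vec.scale_left_diff_distrib)
    moreover have "cinner \<psi> (y - ?p) = 0"
      using assms by (simp add: cinner_smult_right cinner_diff_right cinner_self)
    ultimately have "cinner (?p - z) (y - ?p) = 0"
      by (simp only: cinner_smult_left mult_zero_right)
    then have "orthogonal (?p - z) (y - ?p)"
      unfolding orthogonal_def inner_eq_Re_cinner by simp
    from norm_add_Pythagorean[OF this[unfolded orthogonal_commute[of "?p - z"]]]
    have "(norm (y - ?p))\<^sup>2 \<le> (norm (y - z))\<^sup>2"
      by simp
    then show "dist y ?p \<le> dist y z"
      by (simp add: dist_norm)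
  qed
qed

section \<open>Kernels\<close>

lemma mem_span_singleton: "x \<in> vec.span {y} \<longleftrightarrow> (\<exists>c. x = c *s y)"
  for x y :: "'a::field ^ 'n"
  by (auto simp: vec.span_singleton)

lemma span_singleton_smult:
  fixes x :: "'a::field ^ 'n"
  assumes "c \<noteq> 0"
  shows "vec.span {c *s x} = vec.span {x}"
proof -
  have "d *s x = (d / c) *s (c *s x)" for d
    using assms by simp
  then show ?thesis
    unfolding vec.span_singleton by (fastforce simp: image_iff)
qed

section \<open>Principal minors and the existence and uniqueness of kernel vectors\<close>

text \<open>A permutation that moves a point outside \<open>S\<close> picks up an off-diagonal zero
  of the identity block, so only permutations of \<open>S\<close> contribute. Padding with the
  identity keeps the index type, so that the invertibility criterion for \<open>det\<close> applies
  to minors.\<close>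

lemma principal_det_bordered:
  fixes A :: "'a::comm_ring_1 ^ 'v ^ 'v"
  shows "principal_det S A =
    det (\<chi> i j. if i \<in> S \<and> j \<in> S then A $ i $ j else if i = j then 1 else 0)"
    (is "_ = det ?B")
proof -
  have "det ?B = (\<Sum>p | p permutes UNIV. of_int (sign p) * (\<Prod>i\<in>UNIV. ?B $ i $ p i))"
    by (simp add: det_def)
  also have "\<dots> = (\<Sum>p | p permutes S. of_int (sign p) * (\<Prod>i\<in>UNIV. ?B $ i $ p i))"
  proof (rule sum.mono_neutral_right)
    show "\<forall>p\<in>{p. p permutes UNIV} - {p. p permutes S}.
        of_int (sign p) * (\<Prod>i\<in>UNIV. ?B $ i $ p i) = 0"
    proof
      fix p :: "'v \<Rightarrow> 'v" assume p: "p \<in> {p. p permutes UNIV} - {p. p permutes S}"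
      then obtain i where "i \<notin> S" "p i \<noteq> i"
        by (auto simp: permutes_def)
      then have "?B $ i $ p i = 0"
        by simp
      then have "(\<Prod>i\<in>UNIV. ?B $ i $ p i) = 0"
        by (intro prod_zero finite_class.finite_UNIV bexI[of _ i]) simp_all
      then show "of_int (sign p) * (\<Prod>i\<in>UNIV. ?B $ i $ p i) = 0"
        by simp
    qed
  qed (auto intro: finite_permutations permutes_subset)
  also have "\<dots> = principal_det S A"
    unfolding principal_det_def
  proof (intro sum.cong refl)
    fix p assume "p \<in> {p. p permutes S}"
    then have p: "p permutes S"
      by simp
    have "(\<Prod>i\<in>UNIV. ?B $ i $ p i) = (\<Prod>i\<in>S. ?B $ i $ p i)"
      by (rule prod.mono_neutral_right) (use p in \<open>auto simp: permutes_def\<close>)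
    also have "\<dots> = (\<Prod>i\<in>S. A $ i $ p i)"
      by (intro prod.cong) (simp_all add: permutes_in_image[OF p])
    finally show "of_int (sign p) * (\<Prod>i\<in>UNIV. ?B $ i $ p i) =
        of_int (sign p) * (\<Prod>i\<in>S. A $ i $ p i)"
      by simp
  qed
  finally show ?thesis ..
qed

text \<open>On a vector supported in \<open>S\<close>, the padded matrix agrees with
  \<open>A\<close> in the rows of \<open>S\<close> and gives the zero entries of \<open>x\<close> in
  the others. The vector thus lies in the kernel of an invertible matrix.\<close>

lemma principal_det_nonzero_kernel:
  fixes A :: "'a::field ^ 'v ^ 'v"
  assumes "principal_det S A \<noteq> 0" and "\<And>i. i \<notin> S \<Longrightarrow> x $ i = 0"
    and "\<And>i. i \<in> S \<Longrightarrow> (A *v x) $ i = 0"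
  shows "x = 0"
proof -
  let ?B = "\<chi> i j. if i \<in> S \<and> j \<in> S then A $ i $ j else if i = j then 1 else 0"
  have "(?B *v x) $ i = 0" for i
  proof (cases "i \<in> S")
    case True
    then have "(?B *v x) $ i = (A *v x) $ i"
      using assms(2) by (auto simp: matrix_vector_mult_def intro!: sum.cong)
    then show ?thesis
      using True assms(3) by simp
  next
    case False
    then show ?thesis
      using assms(2) by (auto simp: matrix_vector_mult_def intro!: sum.neutral)
  qed
  then have "?B *v x = 0"
    by (simp add: vec_eq_iff)
  moreover have "invertible ?B"
    using assms(1) by (simp add: invertible_det_nz principal_det_bordered)
  ultimately show "x = 0"
    using matrix_left_invertible_ker[of ?B] by (simp only: invertible_left_inverse)
qed

text \<open>The columns of \<open>A\<close> indexed by \<open>S\<close> live on the rows in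
  \<open>- S\<close>. An injective \<open>A\<close> would therefore embed a space of dimension
  \<open>card S\<close> into one of dimension \<open>card (- S)\<close>, which is smaller.\<close>

lemma exists_kernel_vector:
  fixes A :: "'a::field ^ 'v ^ 'v"
  assumes zero: "\<And>i j. i \<in> S \<Longrightarrow> j \<in> S \<Longrightarrow> A $ i $ j = 0" and card: "card (- S) < card S"
  shows "\<exists>x. x \<noteq> 0 \<and> A *v x = 0"
proof (rule ccontr)
  assume no: "\<not> ?thesis"
  let ?e = "\<lambda>i. axis i 1 :: 'a ^ 'v"
  have inj: "inj ?e"
    by (simp add: inj_on_def axis_eq_axis)
  have "inj ((*v) A)"
    using no by (auto simp: matrix_left_invertible_injective[symmetric] matrix_left_invertible_ker)
  then have "vec.dim ((*v) A ` ?e ` S) = vec.dim (?e ` S)"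
    by (intro vec.dim_image_eq) (auto intro: inj_on_subset simp: matrix_vector_mul_linear_gen)
  also have "vec.independent (?e ` S)"
    by (rule vec.independent_mono[OF independent_cart_basis]) (auto simp: cart_basis_def)
  then have "vec.dim (?e ` S) = card S"
    by (simp add: vec.dim_eq_card_independent card_image inj_on_subset[OF inj])
  finally have dim: "vec.dim ((*v) A ` ?e ` S) = card S" .
  have "(*v) A ` ?e ` S \<subseteq> vec.span (?e ` (- S))"
  proof clarsimp
    fix j assume j: "j \<in> S"
    have "A *v ?e j = (\<Sum>i\<in>- S. A $ i $ j *s ?e i)"
      using zero[OF _ j]
      by (auto simp: vec_eq_iff matrix_vector_mult_def axis_def if_distrib sum.delta cong: if_cong)
    also have "\<dots> \<in> vec.span (?e ` (- S))"
      by (intro vec.span_sum vec.span_scale vec.span_base) auto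
    finally show "A *v ?e j \<in> vec.span (?e ` (- S))" .
  qed
  then have "vec.dim ((*v) A ` ?e ` S) \<le> card (?e ` (- S))"
    by (rule vec.dim_le_card) simp
  also have "\<dots> = card (- S)"
    by (simp add: card_image inj_on_subset[OF inj])
  finally show False
    using dim card by simp
qed

text \<open>A kernel vector that vanishes at one vertex of \<open>P\<close> is supported on the
  rest, where the minor is non-zero, so it is zero. Hence the coordinate at the chosen
  \<open>p\<close> is injective on the kernel, and subtracting a multiple of \<open>x\<close> to
  cancel this coordinate cancels the whole vector.\<close>

lemma kernel_from_vertex_deleted_det:
  fixes A :: "'a::field ^ 'v ^ 'v"
  assumes "p \<in> P" and det: "\<And>p. p \<in> P \<Longrightarrow> principal_det (UNIV - {p}) A \<noteq> 0"
    and "x \<noteq> 0" "A *v x = 0"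
  shows "(\<forall>y. A *v y = 0 \<longrightarrow> (\<exists>c. y = c *s x)) \<and> (\<forall>p\<in>P. x $ p \<noteq> 0)"
proof -
  have *: "z = 0" if "q \<in> P" "A *v z = 0" "z $ q = 0" for q z
    by (rule principal_det_nonzero_kernel[OF det]) (use that in auto)
  have nz: "x $ q \<noteq> 0" if "q \<in> P" for q
    using * assms that by blast
  have "y = (y $ p / x $ p) *s x" if "A *v y = 0" for y
  proof -
    have "y - (y $ p / x $ p) *s x = 0"
    proof (rule *[OF \<open>p \<in> P\<close>])
      show "A *v (y - (y $ p / x $ p) *s x) = 0"
        using that assms(4) by (simp add: matrix_vector_mult_diff_distrib vector_scalar_commute)
      show "(y - (y $ p / x $ p) *s x) $ p = 0"
        using nz[OF \<open>p \<in> P\<close>] by simp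
    qed
    then show ?thesis
      by simp
  qed
  with nz show ?thesis
    by blast
qed

section \<open>Diagonal rescaling of a Hermitian matrix and its zero state\<close>

definition scaled_matrix :: "('v \<Rightarrow> complex) \<Rightarrow> complex ^ 'v ^ 'v \<Rightarrow> complex ^ 'v ^ 'v" where
  "scaled_matrix d A = (\<chi> u v. d u * cnj (d v) * A $ u $ v)"

text \<open>This is the adjugate of the diagonal matrix with entries \<open>cnj (d v)\<close>,
  applied to \<open>\<phi>\<close>.\<close>

definition scaled_zero_state :: "('v \<Rightarrow> complex) \<Rightarrow> complex ^ 'v \<Rightarrow> complex ^ 'v" where
  "scaled_zero_state d \<phi> = (\<chi> v. \<phi> $ v * (\<Prod>u\<in>UNIV - {v}. cnj (d u)))"

lemma scaled_matrix_mult_vec: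
  "(scaled_matrix d A *v x) $ u = d u * (A *v (\<chi> v. cnj (d v) * x $ v)) $ u"
  by (simp add: scaled_matrix_def matrix_vector_mult_def sum_distrib_left mult_ac)

lemma hermitian_scaled_matrix: "hermitian A \<Longrightarrow> hermitian (scaled_matrix d A)"
  unfolding hermitian_def
proof (intro allI)
  fix i j
  assume "\<forall>i j. A $ i $ j = cnj (A $ j $ i)"
  then have "A $ i $ j = cnj (A $ j $ i)"
    by blast
  then show "scaled_matrix d A $ i $ j = cnj (scaled_matrix d A $ j $ i)"
    by (simp add: scaled_matrix_def mult_ac)
qed

lemma scaled_zero_state_at_zero:
  assumes "d p = 0" "v \<noteq> p"
  shows "scaled_zero_state d \<phi> $ v = 0"
  unfolding scaled_zero_state_def using assms
  by (auto intro!: bexI[of _ p])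

text \<open>The component to look at is the one at the zero of \<open>d\<close> if there is one,
  since its product omits the only vanishing factor. Otherwise any component where
  \<open>\<phi>\<close> is non-zero will do.\<close>

lemma scaled_zero_state_nonzero:
  assumes "\<phi> \<noteq> 0" and unique: "\<And>u v. d u = 0 \<Longrightarrow> d v = 0 \<Longrightarrow> u = v"
    and amp: "\<And>u. d u = 0 \<Longrightarrow> \<phi> $ u \<noteq> 0"
  shows "scaled_zero_state d \<phi> \<noteq> 0"
proof -
  obtain v where "\<phi> $ v \<noteq> 0" "\<And>u. u \<noteq> v \<Longrightarrow> d u \<noteq> 0"
  proof (cases "\<exists>p. d p = 0")
    case True
    then show ?thesis
      using that amp unique by metis
  next
    case False
    then show ?thesis
      using that \<open>\<phi> \<noteq> 0\<close> by (metis vec_eq_iff zero_index)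
  qed
  then have "scaled_zero_state d \<phi> $ v \<noteq> 0"
    by (simp add: scaled_zero_state_def)
  then show ?thesis
    by auto
qed

text \<open>Multiplying each component by its missing factor restores the full product, so the
  right-hand diagonal factor maps this vector to a multiple of \<open>\<phi>\<close>. The argument
  does not divide by \<open>d\<close>, so it also covers the zeros of \<open>d\<close>.\<close>

lemma scaled_zero_state_kernel:
  assumes "A *v \<phi> = 0"
  shows "scaled_matrix d A *v scaled_zero_state d \<phi> = 0"
proof -
  have "(\<chi> v. cnj (d v) * scaled_zero_state d \<phi> $ v) = (\<Prod>u\<in>UNIV. cnj (d u)) *s \<phi>"
    unfolding vec_eq_iff
  proof
    fix v
    have "(\<Prod>u\<in>UNIV. cnj (d u)) = cnj (d v) * (\<Prod>u\<in>UNIV - {v}. cnj (d u))"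
      by (rule prod.remove) auto
    then show "(\<chi> v. cnj (d v) * scaled_zero_state d \<phi> $ v) $ v = ((\<Prod>u\<in>UNIV. cnj (d u)) *s \<phi>) $ v"
      by (simp add: scaled_zero_state_def)
  qed
  then have "A *v (\<chi> v. cnj (d v) * scaled_zero_state d \<phi> $ v) = 0"
    by (simp only: vector_scalar_commute assms vec.scale_zero_right)
  then show ?thesis
    unfolding vec_eq_iff scaled_matrix_mult_vec by simp
qed

text \<open>Without zeros of \<open>d\<close>, the diagonal factors are invertible and transport the
  kernel of \<open>A\<close>. At a zero \<open>p\<close> the left factor leaves the component of
  \<open>A *v y\<close> at \<open>p\<close> undetermined; pairing with \<open>\<phi>\<close>
  recovers it, and then the kernel consists of vectors supported at \<open>p\<close>.\<close>

lemma matrix_kernel_scaled_matrix: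
  assumes "hermitian A" and "\<phi> \<noteq> 0" and "A *v \<phi> = 0"
    and ker: "\<And>x. A *v x = 0 \<Longrightarrow> \<exists>c. x = c *s \<phi>"
    and unique: "\<And>u v. d u = 0 \<Longrightarrow> d v = 0 \<Longrightarrow> u = v"
    and amp: "\<And>u. d u = 0 \<Longrightarrow> \<phi> $ u \<noteq> 0"
  shows "matrix_kernel (scaled_matrix d A) = vec.span {scaled_zero_state d \<phi>}"
proof (intro set_eqI iffI)
  let ?z = "scaled_zero_state d \<phi>"
  fix x
  show "x \<in> matrix_kernel (scaled_matrix d A)" if "x \<in> vec.span {?z}"
    using that scaled_zero_state_kernel[OF \<open>A *v \<phi> = 0\<close>, of d]
    by (auto simp: mem_span_singleton matrix_kernel_def vector_scalar_commute)
  assume "x \<in> matrix_kernel (scaled_matrix d A)"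
  then have x: "scaled_matrix d A *v x = 0"
    by (simp add: matrix_kernel_def)
  define y where "y = (\<chi> v. cnj (d v) * x $ v)"
  have Ay: "d u * (A *v y) $ u = 0" for u
    using x by (simp add: vec_eq_iff scaled_matrix_mult_vec y_def)
  show "x \<in> vec.span {?z}"
  proof (cases "\<exists>p. d p = 0")
    case False
    then have nz: "d u \<noteq> 0" for u
      by blast
    then have "A *v y = 0"
      using Ay by (simp add: vec_eq_iff)
    then obtain c where c: "y = c *s \<phi>"
      using ker by blast
    define D where "D = (\<Prod>u\<in>UNIV. cnj (d u))"
    have "D \<noteq> 0"
      using nz by (simp add: D_def)
    have "x $ v = c / D * ?z $ v" for v
    proof -
      have "cnj (d v) * x $ v = c * \<phi> $ v"
        using c by (simp add: y_def vec_eq_iff)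
      moreover have "D = cnj (d v) * (\<Prod>u\<in>UNIV - {v}. cnj (d u))"
        unfolding D_def by (rule prod.remove) auto
      ultimately show ?thesis
        using nz[of v] \<open>D \<noteq> 0\<close> by (simp add: scaled_zero_state_def field_simps)
    qed
    then have "x = (c / D) *s ?z"
      unfolding vec_eq_iff vector_smult_component by blast
    then show ?thesis
      unfolding mem_span_singleton by blast
  next
    case True
    then obtain p where p: "d p = 0"
      by blast
    have supp: "(A *v y) $ u = 0" if "u \<noteq> p" for u
      using Ay[of u] that unique p by auto
    \<comment> \<open>\<open>A\<close> is Hermitian, so its range is orthogonal to \<open>\<phi>\<close>, whose component at \<open>p\<close> does not vanish.\<close>
    have "A *v y = axis p ((A *v y) $ p)"
      using supp by (auto simp: vec_eq_iff axis_def)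
    then have "cinner \<phi> (A *v y) = cnj (\<phi> $ p) * (A *v y) $ p"
      by (metis cinner_axis_right)
    moreover have "cinner \<phi> (A *v y) = 0"
      using \<open>A *v \<phi> = 0\<close> by (simp add: cinner_hermitian[OF \<open>hermitian A\<close>])
    ultimately have "(A *v y) $ p = 0"
      using amp[OF p] by simp
    with supp have "A *v y = 0"
      by (metis vec_eq_iff zero_index)
    then obtain c where c: "y = c *s \<phi>"
      using ker by blast
    \<comment> \<open>The right factor annihilates the component at \<open>p\<close>, whereas
      \<open>\<phi>\<close> is non-zero there, so the coefficient \<open>c\<close> must be
      \<open>0\<close>.\<close>
    have "y $ p = 0"
      by (simp add: y_def p)
    with c amp[OF p] have "y = 0"
      by auto
    have x0: "x $ v = 0" if "v \<noteq> p" for v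
    proof -
      have "d v \<noteq> 0" "y $ v = 0"
        using unique p that \<open>y = 0\<close> by auto
      then show ?thesis
        by (simp add: y_def)
    qed
    have z0: "?z $ v = 0" if "v \<noteq> p" for v
      using scaled_zero_state_at_zero[of d p v, OF p that] .
    moreover have "?z \<noteq> 0"
      using scaled_zero_state_nonzero assms by blast
    ultimately have zp: "?z $ p \<noteq> 0"
      unfolding vec_eq_iff zero_index by metis
    have "x $ v = x $ p / ?z $ p * ?z $ v" for v
      using zp x0 z0 by (cases "v = p") simp_all
    then have "x = (x $ p / ?z $ p) *s ?z"
      unfolding vec_eq_iff vector_smult_component by blast
    then show ?thesis
      unfolding mem_span_singleton by blast
  qed
qed

section \<open>Linear differential equations\<close>

text \<open>Picard iteration in series form: \<open>u n\<close> is the \<open>n\<close>-fold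
  iterated integral starting from the constant \<open>y0\<close>, the factorial bound gives uniform
  convergence, and the series is differentiated term by term. The hypothesis \<open>cont\<close>
  supplies exactly the continuity of the integrands.\<close>

lemma linear_ode_exists:
  fixes G :: "real \<Rightarrow> 'a::banach \<Rightarrow> 'a"
  assumes "0 \<le> b" and K: "0 \<le> K" and lin: "\<And>t. t \<in> {0..b} \<Longrightarrow> linear (G t)"
    and bound: "\<And>t x. t \<in> {0..b} \<Longrightarrow> norm (G t x) \<le> K * norm x"
    and cont: "\<And>u. continuous_on {0..b} u \<Longrightarrow> continuous_on {0..b} (\<lambda>t. G t (u t))"
  shows "\<exists>y. y 0 = y0 \<and> (\<forall>t\<in>{0..b}. (y has_vector_derivative G t (y t)) (at t within {0..b}))"
proof -
  let ?I = "{0..b}"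
  define u where "u = rec_nat (\<lambda>_. y0) (\<lambda>_ v t. integral {0..t} (\<lambda>s. G s (v s)))"
  have u_0: "u 0 = (\<lambda>_. y0)" and
    u_Suc: "u (Suc n) = (\<lambda>t. integral {0..t} (\<lambda>s. G s (u n s)))" for n
    by (simp_all add: u_def)
  have deriv_step: "(u (Suc n) has_vector_derivative G t (u n t)) (at t within ?I)"
    if "continuous_on ?I (u n)" "t \<in> ?I" for n t
    unfolding u_Suc by (rule integral_has_vector_derivative[OF cont[OF that(1)] that(2)])
  have cont_u: "continuous_on ?I (u n)" for n
  proof (induction n)
    case (Suc n)
    then show ?case
      using deriv_step by (meson continuous_on_vector_derivative)
  qed (simp add: u_0)
  have deriv_u: "(u (Suc n) has_vector_derivative G t (u n t)) (at t within ?I)"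
    if "t \<in> ?I" for n t
    using deriv_step cont_u that by blast
  have u_bound: "norm (u n t) \<le> norm y0 * ((K * t) ^ n / fact n)" if "t \<in> ?I" for n t
    using that
  proof (induction n arbitrary: t)
    case (Suc n)
    let ?g = "\<lambda>s. K * (norm y0 * ((K * s) ^ n / fact n))"
    let ?F = "\<lambda>s. norm y0 * ((K * s) ^ Suc n / fact (Suc n))"
    have F: "(?F has_real_derivative ?g s) (at s within {0..t})" for s
    proof -
      have eq: "?F = (\<lambda>s. (norm y0 * K ^ Suc n / fact (Suc n)) * s ^ Suc n)"
        by (auto simp: power_mult_distrib)
      have "(?F has_real_derivative (norm y0 * K ^ Suc n / fact (Suc n)) * (real (Suc n) * s ^ n)) (at s within {0..t})"
        unfolding eq by (intro DERIV_cmult) (use DERIV_pow[of "Suc n" s "{0..t}"] in simp)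
      also have "(norm y0 * K ^ Suc n / fact (Suc n)) * (real (Suc n) * s ^ n) = ?g s"
        by (simp add: power_mult_distrib field_simps del: of_nat_Suc)
      finally show ?thesis .
    qed
    have int: "(?g has_integral ?F t - ?F 0) {0..t}"
      by (rule fundamental_theorem_of_calculus)
         (use Suc.prems F in \<open>auto simp: has_real_derivative_iff_has_vector_derivative\<close>)
    have "norm (u (Suc n) t) \<le> integral {0..t} ?g"
      unfolding u_Suc
    proof (rule integral_norm_bound_integral)
      show "(\<lambda>s. G s (u n s)) integrable_on {0..t}"
        using Suc.prems by (intro integrable_continuous_real continuous_on_subset[OF cont[OF cont_u]]) auto
      show "?g integrable_on {0..t}"
        using int by blast
      show "norm (G s (u n s)) \<le> ?g s" if "s \<in> {0..t}" for s
      proof -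
        have s: "s \<in> ?I" using that Suc.prems by auto
        have "norm (G s (u n s)) \<le> K * norm (u n s)" by (rule bound[OF s])
        also have "\<dots> \<le> ?g s"
          by (rule mult_left_mono[OF Suc.IH[OF s] K])
        finally show ?thesis .
      qed
    qed
    also have "\<dots> = ?F t"
      unfolding integral_unique[OF int] by simp
    finally show ?case .
  qed (simp add: u_0)
  have unif: "uniform_limit ?I (\<lambda>n t. \<Sum>i<n. u i t) (\<lambda>t. \<Sum>i. u i t) sequentially"
  proof (rule Weierstrass_m_test)
    show "norm (u n t) \<le> norm y0 * ((K * b) ^ n / fact n)" if "t \<in> ?I" for n t
      using u_bound[OF that] 
      by (rule order_trans)
         (use that K in \<open>intro mult_left_mono divide_right_mono power_mono; auto simp: mult_left_mono\<close>)
    show "summable (\<lambda>n. norm y0 * ((K * b) ^ n / fact n))"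
      using summable_exp_generic[of "K * b"]
      by (intro summable_mult) (simp add: scaleR_conv_of_real field_simps)
  qed
  define y where "y t = (\<Sum>i. u i t)" for t
  \<comment> \<open>The derivatives of the terms, with the index shifted: the constant term
    contributes \<open>0\<close>, and each later one contributes \<open>G\<close> of its
    predecessor.\<close>
  define u' where "u' n t = (case n of 0 \<Rightarrow> 0 | Suc m \<Rightarrow> G t (u m t))" for n t
  have "\<exists>g. \<forall>t\<in>?I. (\<lambda>n. u n t) sums g t \<and>
      (g has_derivative (\<lambda>h. h *\<^sub>R G t (y t))) (at t within ?I)"
  proof (rule has_derivative_series)
    show "(u n has_derivative (\<lambda>h. h *\<^sub>R u' n t)) (at t within ?I)" if "t \<in> ?I" for n t
      using deriv_u[OF that] by (cases n) (auto simp: u'_def u_0 has_vector_derivative_def)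
    show "0 \<in> ?I" using \<open>0 \<le> b\<close> by simp
    show "(\<lambda>n. u n 0) sums y0"
    proof -
      have "(\<lambda>n. u n 0) = (\<lambda>n. if n = 0 then y0 else 0)"
      proof
        show "u n 0 = (if n = 0 then y0 else 0)" for n
          by (cases n) (simp_all add: u_0 u_Suc)
      qed
      then show ?thesis
        using sums_single[of 0 "\<lambda>_. y0"] by simp
    qed
    fix e :: real assume "e > 0"
    \<comment> \<open>Dividing by \<open>K + 1\<close> instead of \<open>K\<close> covers
      \<open>K = 0\<close> as well.\<close>
    have "e / (K + 1) > 0" using \<open>e > 0\<close> K by simp
    then obtain N where N: "\<And>n t. n \<ge> N \<Longrightarrow> t \<in> ?I \<Longrightarrow> norm ((\<Sum>i<n. u i t) - y t) < e / (K + 1)"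
      using unif unfolding uniform_limit_iff eventually_sequentially dist_norm y_def by meson
    have "norm ((\<Sum>i<n. h *\<^sub>R u' i t) - h *\<^sub>R G t (y t)) \<le> e * norm h"
      if "n \<ge> Suc N" "t \<in> ?I" for n t h
    proof -
      \<comment> \<open>By the index shift, \<open>n\<close> derivative terms sum to
        \<open>G t\<close> of only \<open>m = n - 1\<close> terms of the series; hence the threshold
        \<open>Suc N\<close>.\<close>
      obtain m where m: "n = Suc m" "m \<ge> N"
        using \<open>n \<ge> Suc N\<close> by (metis Suc_le_D Suc_le_mono)
      interpret linear "G t" by (rule lin[OF \<open>t \<in> ?I\<close>])
      have "(\<Sum>i<n. u' i t) = G t (\<Sum>i<m. u i t)"
        by (simp add: m sum.lessThan_Suc_shift u'_def sum del: sum.lessThan_Suc)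
      then have "norm ((\<Sum>i<n. u' i t) - G t (y t)) = norm (G t ((\<Sum>i<m. u i t) - y t))"
        by (simp add: diff)
      also have "\<dots> \<le> K * norm ((\<Sum>i<m. u i t) - y t)"
        by (rule bound[OF \<open>t \<in> ?I\<close>])
      also have "\<dots> \<le> K * (e / (K + 1))"
        using N[OF m(2) \<open>t \<in> ?I\<close>] K by (intro mult_left_mono) auto
      also have "\<dots> \<le> e"
        using K \<open>e > 0\<close> by (simp add: field_simps)
      finally have "norm ((\<Sum>i<n. u' i t) - G t (y t)) \<le> e" .
      then have "norm (h *\<^sub>R ((\<Sum>i<n. u' i t) - G t (y t))) \<le> e * norm h"
        by (simp add: mult.commute[of e] mult_left_mono)
      then show ?thesis
        by (simp add: scaleR_diff_right scaleR_sum_right)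
    qed
    then show "\<forall>\<^sub>F n in sequentially. \<forall>t\<in>?I. \<forall>h.
        norm ((\<Sum>i<n. h *\<^sub>R u' i t) - h *\<^sub>R G t (y t)) \<le> e * norm h"
      unfolding eventually_sequentially by blast
  qed simp
  then obtain g where g: "\<And>t. t \<in> ?I \<Longrightarrow> (\<lambda>n. u n t) sums g t"
    "\<And>t. t \<in> ?I \<Longrightarrow> (g has_derivative (\<lambda>h. h *\<^sub>R G t (y t))) (at t within ?I)"
    by blast
  \<comment> \<open>The series theorem yields its own sum \<open>g\<close>; only on the interval is
    it known to agree with \<open>y\<close>.\<close>
  have gy: "g t = y t" if "t \<in> ?I" for t
    using g(1)[OF that] by (simp add: y_def sums_iff)
  have "g 0 = y0"
  proof -
    have "u n 0 = (if n = 0 then y0 else 0)" for n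
      by (cases n) (simp_all add: u_0 u_Suc)
    then have "(\<lambda>n. u n 0) sums y0"
      using sums_single[of 0 "\<lambda>_. y0"] by simp
    then show ?thesis
      using g(1)[of 0] \<open>0 \<le> b\<close> sums_unique2 by fastforce
  qed
  moreover have "(g has_vector_derivative G t (g t)) (at t within ?I)" if "t \<in> ?I" for t
    using g(2)[OF that] gy[OF that] by (simp add: has_vector_derivative_def)
  ultimately show ?thesis
    by blast
qed

section \<open>Differentiable controls\<close>

text \<open>A finite-order counterpart of \<open>smooth_on\<close>. The recursion through the
  derivative makes closure under algebraic operations a plain induction; the adiabatic argument
  needs only orders \<open>1\<close> and \<open>2\<close>.\<close>

primrec Ck_on :: "nat \<Rightarrow> real set \<Rightarrow> (real \<Rightarrow> complex) \<Rightarrow> bool" where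
  "Ck_on 0 I f \<longleftrightarrow> continuous_on I f"
| "Ck_on (Suc k) I f \<longleftrightarrow>
    (\<exists>f'. (\<forall>t\<in>I. (f has_vector_derivative f' t) (at t within I)) \<and> Ck_on k I f')"

lemma Ck_on_SucD: "Ck_on (Suc k) I f \<Longrightarrow> Ck_on k I f"
proof (induction k arbitrary: f)
  case 0
  then show ?case
    by (auto intro: continuous_on_vector_derivative)
next
  case (Suc k)
  then show ?case
    by (metis Ck_on.simps(2))
qed

lemma Ck_on_continuous_on: "Ck_on k I f \<Longrightarrow> continuous_on I f"
  by (induction k) (auto simp del: Ck_on.simps(2) dest: Ck_on_SucD)

lemma Ck_on_const: "Ck_on k I (\<lambda>_. c)"
proof (induction k arbitrary: c)
  case (Suc k)
  have "\<forall>t\<in>I. ((\<lambda>_. c) has_vector_derivative 0) (at t within I)"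
    by simp
  with Suc[of 0] show ?case
    unfolding Ck_on.simps by (intro exI conjI)
qed simp

lemma Ck_on_add: "Ck_on k I f \<Longrightarrow> Ck_on k I g \<Longrightarrow> Ck_on k I (\<lambda>t. f t + g t)"
proof (induction k arbitrary: f g)
  case (Suc k)
  then obtain f' g' where
    "\<forall>t\<in>I. (f has_vector_derivative f' t) (at t within I)" "Ck_on k I f'"
    "\<forall>t\<in>I. (g has_vector_derivative g' t) (at t within I)" "Ck_on k I g'"
    by auto
  then show ?case
    using Suc.IH by (auto intro!: exI[of _ "\<lambda>t. f' t + g' t"] has_vector_derivative_add)
qed (auto intro: continuous_intros)

lemma Ck_on_mult: "Ck_on k I f \<Longrightarrow> Ck_on k I g \<Longrightarrow> Ck_on k I (\<lambda>t. f t * g t)"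
proof (induction k arbitrary: f g)
  case (Suc k)
  then obtain f' g' where
    "\<forall>t\<in>I. (f has_vector_derivative f' t) (at t within I)" "Ck_on k I f'"
    "\<forall>t\<in>I. (g has_vector_derivative g' t) (at t within I)" "Ck_on k I g'"
    by auto
  then show ?case
    using Suc.IH Ck_on_SucD[OF Suc.prems(1)] Ck_on_SucD[OF Suc.prems(2)]
    by (auto intro!: exI[of _ "\<lambda>t. f t * g' t + f' t * g t"] has_vector_derivative_mult Ck_on_add)
qed (auto intro: continuous_intros)

lemma Ck_on_diff:
  assumes "Ck_on k I f" "Ck_on k I g"
  shows "Ck_on k I (\<lambda>t. f t - g t)"
  using Ck_on_add[OF assms(1) Ck_on_mult[OF Ck_on_const[of k I "-1"] assms(2)]] by simp

lemma Ck_on_cnj: "Ck_on k I f \<Longrightarrow> Ck_on k I (\<lambda>t. cnj (f t))"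
proof (induction k arbitrary: f)
  case (Suc k)
  then obtain f' where
    "\<forall>t\<in>I. (f has_vector_derivative f' t) (at t within I)" "Ck_on k I f'"
    by auto
  then show ?case
    using Suc.IH by (auto intro!: exI[of _ "\<lambda>t. cnj (f' t)"] has_vector_derivative_cnj)
qed (auto intro: continuous_intros)

text \<open>The derivative is a product of \<open>f'\<close> with two copies of the inverse itself,
  which has order \<open>k\<close> by induction. Each step therefore gains one order.\<close>

lemma Ck_on_inverse:
  assumes "\<And>t. t \<in> I \<Longrightarrow> f t \<noteq> 0"
  shows "Ck_on k I f \<Longrightarrow> Ck_on k I (\<lambda>t. inverse (f t))"
proof (induction k)
  case (Suc k)
  then obtain f' where f':
    "\<forall>t\<in>I. (f has_vector_derivative f' t) (at t within I)" "Ck_on k I f'"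
    by auto
  have inv: "Ck_on k I (\<lambda>t. inverse (f t))"
    using Suc.IH Ck_on_SucD[OF Suc.prems] by blast
  have deriv: "((\<lambda>t. inverse (f t)) has_vector_derivative
      (- 1) * (inverse (f t) * f' t * inverse (f t))) (at t within I)" if "t \<in> I" for t
  proof -
    have "(f has_derivative (\<lambda>h. h *\<^sub>R f' t)) (at t within I)"
      using f' that by (simp add: has_vector_derivative_def)
    from Deriv.has_derivative_inverse[OF assms[OF that] this] show ?thesis
      by (simp add: has_vector_derivative_def)
  qed
  have "Ck_on k I (\<lambda>t. (- 1) * (inverse (f t) * f' t * inverse (f t)))"
    by (intro Ck_on_mult Ck_on_const inv f'(2))
  with deriv show ?case
    unfolding Ck_on.simps by (intro exI conjI ballI) (assumption | rule deriv)+
qed (auto intro!: continuous_intros assms)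

lemma Ck_on_divide:
  assumes "Ck_on k I f" "Ck_on k I g" "\<And>t. t \<in> I \<Longrightarrow> g t \<noteq> 0"
  shows "Ck_on k I (\<lambda>t. f t / g t)"
  using Ck_on_mult[OF assms(1) Ck_on_inverse[OF assms(3,2)]] by (simp add: divide_inverse)

lemma Ck_on_sum: "(\<And>i. i \<in> S \<Longrightarrow> Ck_on k I (f i)) \<Longrightarrow> Ck_on k I (\<lambda>t. \<Sum>i\<in>S. f i t)"
  by (induction S rule: infinite_finite_induct) (auto intro: Ck_on_const Ck_on_add)

lemma Ck_on_prod: "(\<And>i. i \<in> S \<Longrightarrow> Ck_on k I (f i)) \<Longrightarrow> Ck_on k I (\<lambda>t. \<Prod>i\<in>S. f i t)"
  by (induction S rule: infinite_finite_induct) (auto intro: Ck_on_const Ck_on_mult)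

lemma Ck_on_det:
  fixes A :: "real \<Rightarrow> complex ^ 'n ^ 'n"
  assumes "\<And>i j. Ck_on k I (\<lambda>t. A t $ i $ j)"
  shows "Ck_on k I (\<lambda>t. det (A t))"
  unfolding det_def by (intro Ck_on_sum Ck_on_mult Ck_on_prod Ck_on_const assms)

text \<open>The induction treats all derivatives \<open>g n\<close> at once. As \<open>g 0\<close>
  and \<open>f\<close> agree only on \<open>I\<close>, their derivatives are compared within
  \<open>I\<close>, which gives order \<open>Suc k\<close> for \<open>f\<close>; this is then
  lowered to \<open>k\<close>.\<close>

lemma smooth_on_imp_Ck_on:
  fixes f :: "real \<Rightarrow> complex"
  assumes "smooth_on I f"
  shows "Ck_on k I f"
proof -
  obtain g where g: "\<And>t. t \<in> I \<Longrightarrow> g 0 t = f t"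
    "\<And>n t. t \<in> I \<Longrightarrow> (g n has_vector_derivative g (Suc n) t) (at t within I)"
    using assms unfolding smooth_on_def by blast
  have "Ck_on k I (g n)" for n
    by (induction k arbitrary: n) (use g(2) in \<open>auto intro: continuous_on_vector_derivative\<close>)
  moreover have "(f has_vector_derivative g 1 t) (at t within I)" if "t \<in> I" for t
    using has_vector_derivative_transform[OF that _ g(2)[OF that, of 0], of f] g(1) by simp
  ultimately have "Ck_on (Suc k) I f"
    by auto
  then show ?thesis
    by (rule Ck_on_SucD)
qed

section \<open>The adiabatic limit\<close>

lemma has_vector_derivative_vec_nth:
  "(x has_vector_derivative x') F \<Longrightarrow> ((\<lambda>t. x t $ i) has_vector_derivative x' $ i) F"
  by (rule bounded_linear.has_vector_derivative[OF bounded_linear_vec_nth])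

lemma has_vector_derivative_vec_lambda:
  fixes f :: "'n::finite \<Rightarrow> real \<Rightarrow> 'a::euclidean_space"
  assumes "\<And>i. (f i has_vector_derivative f' i) (at t within S)"
  shows "((\<lambda>t. \<chi> i. f i t) has_vector_derivative (\<chi> i. f' i)) (at t within S)"
  unfolding has_vector_derivative_def
proof (subst has_derivative_componentwise_within, rule ballI)
  fix b :: "'a ^ 'n" assume "b \<in> Basis"
  then obtain i u where b: "b = axis i u"
    by (auto simp: Basis_vec_def)
  have "(f i has_derivative (\<lambda>h. h *\<^sub>R f' i)) (at t within S)"
    using assms[of i] by (simp add: has_vector_derivative_def)
  from has_derivative_inner_left[OF this, of u]
  show "((\<lambda>s. (\<chi> i. f i s) \<bullet> b) has_derivative (\<lambda>h. (h *\<^sub>R (\<chi> i. f' i)) \<bullet> b)) (at t within S)"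
    by (simp add: b inner_axis)
qed

lemma has_vector_derivative_cinner:
  assumes "(x has_vector_derivative x') (at t within S)"
    and "(y has_vector_derivative y') (at t within S)"
  shows "((\<lambda>t. cinner (x t) (y t)) has_vector_derivative cinner (x t) y' + cinner x' (y t))
    (at t within S)"
  unfolding cinner_def sum.distrib[symmetric]
  by (intro has_vector_derivative_sum has_vector_derivative_mult has_vector_derivative_cnj
      has_vector_derivative_vec_nth assms)

text \<open>The mean value inequality with one-sided derivatives at the end points. With
  \<open>B = 0\<close> it serves as a conservation law for norms.\<close>

lemma norm_diff_le_of_vector_derivative:
  fixes f :: "real \<Rightarrow> 'a::real_normed_vector"
  assumes "\<And>t. t \<in> {a..b} \<Longrightarrow> (f has_vector_derivative f' t) (at t within {a..b})"
    and "\<And>t. t \<in> {a..b} \<Longrightarrow> norm (f' t) \<le> B" and "x \<in> {a..b}" "y \<in> {a..b}"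
  shows "norm (f x - f y) \<le> B * \<bar>x - y\<bar>"
proof -
  have "norm (f x - f y) \<le> B * norm (x - y)"
  proof (rule differentiable_bound)
    show "(f has_derivative (\<lambda>h. h *\<^sub>R f' t)) (at t within {a..b})" if "t \<in> {a..b}" for t
      using assms(1)[OF that] by (simp add: has_vector_derivative_def)
    show "onorm (\<lambda>h. h *\<^sub>R f' t) \<le> B" if "t \<in> {a..b}" for t
      by (rule onorm_le) (use assms(2)[OF that] in \<open>simp add: mult.commute[of B] mult_left_mono\<close>)
  qed (use assms in auto)
  then show ?thesis
    by simp
qed

lemma rescaled_time_mem:
  fixes T \<tau> :: real
  assumes "0 < \<tau>" "0 \<le> T" "t \<in> {0..\<tau>}"
  shows "t * T / \<tau> \<in> {0..T}"
  using assms by (auto simp: divide_simps mult.commute[of T] intro: mult_right_mono)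

lemma has_vector_derivative_rescaled:
  fixes e :: "real \<Rightarrow> 'a::real_normed_vector"
  assumes "\<And>s. s \<in> {0..T} \<Longrightarrow> (e has_vector_derivative e' s) (at s within {0..T})"
    and "0 < \<tau>" "0 \<le> T" "t \<in> {0..\<tau>}"
  shows "((\<lambda>t. e (t * T / \<tau>)) has_vector_derivative (T / \<tau>) *\<^sub>R e' (t * T / \<tau>))
    (at t within {0..\<tau>})"
proof -
  have sub: "(\<lambda>t. t * T / \<tau>) ` {0..\<tau>} \<subseteq> {0..T}"
    using rescaled_time_mem[OF assms(2,3)] by blast
  have "t * T / \<tau> \<in> {0..T}"
    by (rule rescaled_time_mem[OF assms(2-4)])
  have "((\<lambda>t. t * T / \<tau>) has_real_derivative 1 * T / \<tau>) (at t within {0..\<tau>})"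
    by (intro DERIV_cdivide DERIV_cmult_right DERIV_ident)
  then have "((\<lambda>t. t * T / \<tau>) has_vector_derivative T / \<tau>) (at t within {0..\<tau>})"
    by (simp add: has_real_derivative_iff_has_vector_derivative)
  from vector_diff_chain_within[OF this has_vector_derivative_within_subset[OF assms(1)[OF \<open>t * T / \<tau> \<in> {0..T}\<close>] sub]]
  show ?thesis
    by (simp add: o_def)
qed

text \<open>A crude operator bound, chosen because it is visibly continuous in the entries and hence
  bounded along a continuous Hamiltonian on a compact interval.\<close>

lemma norm_matrix_vector_mult_le:
  fixes A :: "complex ^ 'n ^ 'm"
  shows "norm (A *v x) \<le> (\<Sum>i\<in>UNIV. \<Sum>j\<in>UNIV. cmod (A $ i $ j)) * norm x"
proof -
  have "norm (A *v x) \<le> (\<Sum>i\<in>UNIV. cmod ((A *v x) $ i))"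
    unfolding norm_vec_def by (rule L2_set_le_sum) simp
  also have "\<dots> \<le> (\<Sum>i\<in>UNIV. \<Sum>j\<in>UNIV. cmod (A $ i $ j) * norm x)"
    unfolding matrix_vector_mult_def
    by (auto intro!: sum_mono sum_norm_le mult_left_mono Finite_Cartesian_Product.norm_nth_le simp: norm_mult)
  finally show ?thesis
    by (simp add: sum_distrib_right)
qed

section \<open>Solutions of the Schroedinger equation and their norm\<close>

lemma schroedinger_solution_exists:
  fixes H :: "real \<Rightarrow> complex ^ 'v ^ 'v"
  assumes "0 < hbar" "0 \<le> T" "0 < \<tau>"
    and cont: "\<And>i j. continuous_on {0..T} (\<lambda>s. H s $ i $ j)"
  shows "\<exists>\<psi>. schroedinger_solution hbar T H a \<tau> \<psi>"
proof -
  let ?c = "\<i> * complex_of_real hbar" and ?H = "\<lambda>t. H (t * T / \<tau>)"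
  have c: "?c \<noteq> 0" "cmod ?c = hbar"
    using assms(1) by (simp_all add: norm_mult)
  let ?S = "\<lambda>A :: complex ^ 'v ^ 'v. \<Sum>i\<in>UNIV. \<Sum>j\<in>UNIV. cmod (A $ i $ j)"
  have "compact ((\<lambda>s. ?S (H s)) ` {0..T})"
    by (intro compact_continuous_image continuous_on_sum continuous_on_norm cont) simp
  from compact_imp_bounded[OF this] obtain B where "0 < B"
    and *: "\<And>y. y \<in> (\<lambda>s. ?S (H s)) ` {0..T} \<Longrightarrow> norm y \<le> B"
    unfolding bounded_pos by blast
  have B: "0 < B" "?S (H s) \<le> B" if "s \<in> {0..T}" for s
    using \<open>0 < B\<close> *[OF imageI[OF that]] by simp_all
  have contH: "continuous_on {0..\<tau>} (\<lambda>t. ?H t $ i $ j)" for i j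
    by (rule continuous_on_compose2[OF cont[of i j]])
      (use rescaled_time_mem[OF assms(3,2)] assms(3) in \<open>auto intro!: continuous_intros\<close>)
  have "\<exists>\<psi>. \<psi> 0 = axis a 1 \<and>
      (\<forall>t\<in>{0..\<tau>}. (\<psi> has_vector_derivative inverse ?c *s (?H t *v \<psi> t)) (at t within {0..\<tau>}))"
  proof (rule linear_ode_exists)
    show "0 \<le> \<tau>" "0 \<le> B / hbar"
      using assms \<open>0 < B\<close> by simp_all
    fix t assume t: "t \<in> {0..\<tau>}"
    show "linear (\<lambda>x. inverse ?c *s (?H t *v x))"
      by (rule linearI)
        (simp_all add: matrix_vector_right_distrib vec.scale_right_distrib scaleR_eq_smult
          vector_scalar_commute vector_smult_assoc mult.commute)
    fix x
    have "norm (inverse ?c *s (?H t *v x)) = norm (?H t *v x) / hbar"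
      using c by (simp add: norm_smult_vec norm_inverse divide_inverse mult.commute del: inverse_mult_distrib)
    also have "\<dots> \<le> ?S (?H t) * norm x / hbar"
      using assms(1) by (intro divide_right_mono norm_matrix_vector_mult_le) simp
    also have "\<dots> \<le> B * norm x / hbar"
      using assms(1) B(2)[OF rescaled_time_mem[OF assms(3,2) t]]
      by (intro divide_right_mono mult_right_mono) simp_all
    finally show "norm (inverse ?c *s (?H t *v x)) \<le> B / hbar * norm x"
      by simp
  next
    fix u :: "real \<Rightarrow> complex ^ 'v" assume u: "continuous_on {0..\<tau>} u"
    have "inverse ?c *s (?H t *v u t) = (\<chi> i. inverse ?c * (\<Sum>j\<in>UNIV. ?H t $ i $ j * u t $ j))" for t
      by (simp add: vec_eq_iff matrix_vector_mult_def)
    then show "continuous_on {0..\<tau>} (\<lambda>t. inverse ?c *s (?H t *v u t))"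
      by (simp only:) (intro continuous_intros contH continuous_on_component u)
  qed
  then obtain \<psi> where "\<psi> 0 = axis a 1"
    "\<And>t. t \<in> {0..\<tau>} \<Longrightarrow>
      (\<psi> has_vector_derivative inverse ?c *s (?H t *v \<psi> t)) (at t within {0..\<tau>})"
    by blast
  moreover have "?c *s (inverse ?c *s x) = x" for x :: "complex ^ 'v"
    using c(1) by (simp only: vector_smult_assoc right_inverse vector_smult_lid not_False_eq_True)
  ultimately show ?thesis
    unfolding schroedinger_solution_def by metis
qed

lemma schroedinger_solution_norm:
  fixes H :: "real \<Rightarrow> complex ^ 'v ^ 'v"
  assumes sol: "schroedinger_solution hbar T H a \<tau> \<psi>"
    and "0 < hbar" "0 \<le> T" "0 < \<tau>" and herm: "\<And>s. s \<in> {0..T} \<Longrightarrow> hermitian (H s)"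
    and t: "t \<in> {0..\<tau>}"
  shows "norm (\<psi> t) = 1"
proof -
  let ?c = "\<i> * complex_of_real hbar"
  have deriv: "((\<lambda>t. cinner (\<psi> t) (\<psi> t)) has_vector_derivative 0) (at t within {0..\<tau>})"
    if t: "t \<in> {0..\<tau>}" for t
  proof -
    obtain \<psi>' where \<psi>': "(\<psi> has_vector_derivative \<psi>') (at t within {0..\<tau>})"
      "?c *s \<psi>' = H (t * T / \<tau>) *v \<psi> t"
      using sol t unfolding schroedinger_solution_def by blast
    have "?c * cinner (\<psi> t) \<psi>' = cinner (?c *s \<psi>') (\<psi> t)"
      using cinner_hermitian[OF herm[OF rescaled_time_mem[OF assms(4,3) t]], of "\<psi> t" "\<psi> t"]
      by (simp add: \<psi>'(2) flip: cinner_smult_right)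
    \<comment> \<open>The sign is that of \<open>cnj ?c = - ?c\<close>: a Hermitian Hamiltonian with
      an imaginary factor makes the two halves of the derivative of the squared norm cancel.\<close>
    also have "\<dots> = - (?c * cinner \<psi>' (\<psi> t))"
      by (simp add: cinner_smult_left)
    finally have "?c * (cinner (\<psi> t) \<psi>' + cinner \<psi>' (\<psi> t)) = 0"
      by (simp add: algebra_simps)
    then have "cinner (\<psi> t) \<psi>' + cinner \<psi>' (\<psi> t) = 0"
      using \<open>0 < hbar\<close> by simp
    with has_vector_derivative_cinner[OF \<psi>'(1) \<psi>'(1)] show ?thesis
      by simp
  qed
  have "norm (cinner (\<psi> t) (\<psi> t) - cinner (\<psi> 0) (\<psi> 0)) \<le> 0 * \<bar>t - 0\<bar>"
    by (rule norm_diff_le_of_vector_derivative[OF deriv]) (use t \<open>0 < \<tau>\<close> in auto)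
  then have "cinner (\<psi> t) (\<psi> t) = 1"
    using sol by (simp add: schroedinger_solution_def cinner_axis_left)
  then have "(norm (\<psi> t))\<^sup>2 = 1"
    by (simp add: cinner_self flip: of_real_power)
  then show ?thesis
    by (simp add: power2_eq_1_iff) (smt (verit) norm_ge_zero)
qed

text \<open>Since \<open>H e = 0\<close> and \<open>e' = H g\<close>, the derivative of \<open>\<langle>e, \<psi>\<rangle>\<close> is \<open>\<langle>g, H \<psi>\<rangle>\<close>, which by the
  Schroedinger equation is \<open>i hbar T/\<tau>\<close> times \<open>\<langle>g, \<psi>'\<rangle>\<close>; subtracting \<open>i hbar T/\<tau> \<langle>g, \<psi>\<rangle>\<close> is an
  integration by parts.\<close>

lemma adiabatic_estimate:
  fixes H :: "real \<Rightarrow> complex ^ 'v ^ 'v"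
  assumes sol: "schroedinger_solution hbar T H a \<tau> \<psi>"
    and pos: "0 < hbar" "0 < T" "0 < \<tau>"
    and herm: "\<And>s. s \<in> {0..T} \<Longrightarrow> hermitian (H s)"
    and ker: "\<And>s. s \<in> {0..T} \<Longrightarrow> H s *v e s = 0"
    and e: "\<And>s. s \<in> {0..T} \<Longrightarrow> (e has_vector_derivative H s *v g s) (at s within {0..T})"
    and g: "\<And>s. s \<in> {0..T} \<Longrightarrow> (g has_vector_derivative g' s) (at s within {0..T})"
    and B: "\<And>s. s \<in> {0..T} \<Longrightarrow> norm (g s) \<le> B" "\<And>s. s \<in> {0..T} \<Longrightarrow> norm (g' s) \<le> B"
  shows "cmod (cinner (e T) (\<psi> \<tau>) - cinner (e 0) (\<psi> 0)) \<le> hbar * T * B * (T + 2) / \<tau>"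
proof -
  have T0: "0 \<le> T" using pos by simp
  let ?s = "\<lambda>t. t * T / \<tau>"
  define \<kappa> where "\<kappa> = \<i> * complex_of_real (hbar * T / \<tau>)"
  have norm_\<kappa>: "cmod \<kappa> = hbar * T / \<tau>"
    using pos by (simp add: \<kappa>_def norm_mult norm_divide)
  have norm_\<psi>: "norm (\<psi> t) = 1" if "t \<in> {0..\<tau>}" for t
    by (rule schroedinger_solution_norm[OF sol pos(1) T0 pos(3) herm that])
  define h where "h t = cinner (e (?s t)) (\<psi> t) - \<kappa> * cinner (g (?s t)) (\<psi> t)" for t
  define h' where "h' t = - (\<kappa> * cinner ((T / \<tau>) *\<^sub>R g' (?s t)) (\<psi> t))" for t
  have deriv: "(h has_vector_derivative h' t) (at t within {0..\<tau>})" if t: "t \<in> {0..\<tau>}" for t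
  proof -
    have s: "?s t \<in> {0..T}"
      by (rule rescaled_time_mem[OF pos(3) T0 t])
    obtain \<psi>' where \<psi>': "(\<psi> has_vector_derivative \<psi>') (at t within {0..\<tau>})"
      "(\<i> * complex_of_real hbar) *s \<psi>' = H (?s t) *v \<psi> t"
      using sol t unfolding schroedinger_solution_def by blast
    have "\<i> * complex_of_real hbar * cinner (e (?s t)) \<psi>' = 0"
      using cinner_hermitian[OF herm[OF s], of "e (?s t)" "\<psi> t"]
      by (simp add: \<psi>'(2) ker[OF s] flip: cinner_smult_right)
    then have 1: "cinner (e (?s t)) \<psi>' = 0"
      using pos by simp
    have "cinner (H (?s t) *v g (?s t)) (\<psi> t) = \<i> * complex_of_real hbar * cinner (g (?s t)) \<psi>'"
      by (simp add: \<psi>'(2) cinner_hermitian[OF herm[OF s], symmetric] flip: cinner_smult_right)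
    then have 2: "cinner ((T / \<tau>) *\<^sub>R (H (?s t) *v g (?s t))) (\<psi> t) = \<kappa> * cinner (g (?s t)) \<psi>'"
      by (simp add: scaleR_eq_smult cinner_smult_left \<kappa>_def)
    have "(h has_vector_derivative
        (cinner (e (?s t)) \<psi>' + cinner ((T / \<tau>) *\<^sub>R (H (?s t) *v g (?s t))) (\<psi> t))
        - \<kappa> * (cinner (g (?s t)) \<psi>' + cinner ((T / \<tau>) *\<^sub>R g' (?s t)) (\<psi> t))) (at t within {0..\<tau>})"
      unfolding h_def
      by (intro has_vector_derivative_diff has_vector_derivative_mult_right has_vector_derivative_cinner
          has_vector_derivative_rescaled[OF e pos(3) T0 t]
          has_vector_derivative_rescaled[OF g pos(3) T0 t] \<psi>'(1))
    then show ?thesis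
      unfolding 1 2 h'_def by (simp only: add_0 distrib_left diff_add_eq_diff_diff_swap) simp
  qed
  have "0 \<le> B"
    using B(1)[of 0] T0 norm_ge_zero[of "g 0"] by (meson atLeastAtMost_iff order_refl order_trans)
  \<comment> \<open>One factor \<open>1 / \<tau>\<close> comes from \<open>\<kappa>\<close> and one
    from the rescaled \<open>g'\<close>; integration over an interval of length
    \<open>\<tau>\<close> uses up one of them.\<close>
  have "norm (h' t) \<le> hbar * T / \<tau> * (T / \<tau> * B)" if t: "t \<in> {0..\<tau>}" for t
  proof -
    have "cmod (cinner ((T / \<tau>) *\<^sub>R g' (?s t)) (\<psi> t)) \<le> T / \<tau> * norm (g' (?s t))"
      using norm_cinner_le[of "(T / \<tau>) *\<^sub>R g' (?s t)" "\<psi> t"] norm_\<psi>[OF t] pos by simp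
    also have "\<dots> \<le> T / \<tau> * B"
      using B(2)[OF rescaled_time_mem[OF pos(3) T0 t]] pos by (intro mult_left_mono) auto
    finally show ?thesis
      unfolding h'_def norm_minus_cancel norm_mult norm_\<kappa> using pos by (intro mult_left_mono) auto
  qed
  from norm_diff_le_of_vector_derivative[OF deriv this, of \<tau> 0]
  have h: "cmod (h \<tau> - h 0) \<le> hbar * T / \<tau> * (T * B)"
    using pos by (simp add: field_simps)
  \<comment> \<open>The boundary terms of the integration by parts. There are two of them, which
    accounts for the \<open>2\<close> in \<open>T + 2\<close>.\<close>
  have end_bound: "cmod (\<kappa> * cinner (g s) (\<psi> t)) \<le> hbar * T / \<tau> * B"
    if "s \<in> {0..T}" "t \<in> {0..\<tau>}" for s t
  proof -
    have "cmod (cinner (g s) (\<psi> t)) \<le> B"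
      using norm_cinner_le[of "g s" "\<psi> t"] norm_\<psi>[OF that(2)] B(1)[OF that(1)] by simp
    then show ?thesis
      unfolding norm_mult norm_\<kappa> using pos by (intro mult_left_mono) auto
  qed
  have "cinner (e T) (\<psi> \<tau>) - cinner (e 0) (\<psi> 0) =
      (h \<tau> - h 0) + (\<kappa> * cinner (g T) (\<psi> \<tau>) - \<kappa> * cinner (g 0) (\<psi> 0))"
    using pos by (simp add: h_def)
  also have "cmod \<dots> \<le> hbar * T / \<tau> * (T * B) + (hbar * T / \<tau> * B + hbar * T / \<tau> * B)"
    by (intro norm_triangle_le add_mono h order_trans[OF norm_triangle_ineq4] end_bound)
      (use pos in auto)
  also have "\<dots> = hbar * T * B * (T + 2) / \<tau>"
    by (simp add: algebra_simps add_divide_distrib)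
  finally show ?thesis .
qed

lemma bounded_vec_of_continuous_components:
  fixes f :: "real \<Rightarrow> complex ^ 'n"
  assumes "\<And>i. continuous_on {a..b} (\<lambda>s. f s $ i)"
  shows "\<exists>B. \<forall>s\<in>{a..b}. norm (f s) \<le> B"
proof -
  have "continuous_on {a..b} (\<lambda>s. \<chi> i. f s $ i)"
    by (intro continuous_on_vec_lambda assms)
  then have "compact (f ` {a..b})"
    by (intro compact_continuous_image) simp_all
  then show ?thesis
    by (auto dest!: compact_imp_bounded simp: bounded_iff)
qed

text \<open>The gauge of \<open>e\<close> is chosen such that \<open>e'\<close> is orthogonal to the kernel. Then \<open>e' = H g\<close> is
  solvable; \<open>g\<close> is found by Cramer's rule for the invertible matrix \<open>H + |x\<rangle>\<langle>x|\<close>.\<close>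

lemma adiabatic_frame:
  fixes H :: "real \<Rightarrow> complex ^ 'v ^ 'v" and x :: "real \<Rightarrow> complex ^ 'v"
  assumes herm: "\<And>s. s \<in> {0..T} \<Longrightarrow> hermitian (H s)"
    and H: "\<And>i j. Ck_on 1 {0..T} (\<lambda>s. H s $ i $ j)"
    and x: "\<And>i. Ck_on 2 {0..T} (\<lambda>s. x s $ i)"
    and nz: "\<And>s. s \<in> {0..T} \<Longrightarrow> x s \<noteq> 0"
    and ker: "\<And>s. s \<in> {0..T} \<Longrightarrow> matrix_kernel (H s) = vec.span {x s}"
  shows "\<exists>k g g' B. \<forall>s\<in>{0..T}. k s \<noteq> 0 \<and>
      ((\<lambda>s. k s *s x s) has_vector_derivative H s *v g s) (at s within {0..T}) \<and>
      (g has_vector_derivative g' s) (at s within {0..T}) \<and> norm (g s) \<le> B \<and> norm (g' s) \<le> B"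
proof -
  let ?I = "{0..T}"
  have x1: "Ck_on 1 ?I (\<lambda>s. x s $ i)" for i
    using Ck_on_SucD[of 1 ?I "\<lambda>s. x s $ i"] x[of i] by (simp only: Suc_1)
  \<comment> \<open>Order \<open>2\<close> for \<open>x\<close> is what makes \<open>dx\<close>, and
    later \<open>g\<close>, continuously differentiable.\<close>
  have "\<exists>f'. (\<forall>s\<in>?I. ((\<lambda>s. x s $ i) has_vector_derivative f' s) (at s within ?I)) \<and> Ck_on 1 ?I f'" for i
    using x[of i] unfolding numeral_2_eq_2 One_nat_def Ck_on.simps(2)[of "Suc 0"] .
  then obtain x' where x': "\<And>i s. s \<in> ?I \<Longrightarrow> ((\<lambda>s. x s $ i) has_vector_derivative x' i s) (at s within ?I)"
    "\<And>i. Ck_on 1 ?I (x' i)"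
    by metis
  define dx where "dx s = (\<chi> i. x' i s)" for s
  have deriv_x: "(x has_vector_derivative dx s) (at s within ?I)" if "s \<in> ?I" for s
    using has_vector_derivative_vec_lambda[of "\<lambda>i s. x s $ i" "\<lambda>i. x' i s", OF x'(1)[OF that]]
    by (simp add: dx_def)
  have Hx: "H s *v x s = 0" if "s \<in> ?I" for s
  proof -
    have "x s \<in> matrix_kernel (H s)"
      using ker[OF that] by (simp add: vec.span_base)
    then show ?thesis
      by (simp add: matrix_kernel_def)
  qed
  have Ck_cinner: "Ck_on 1 ?I (\<lambda>s. cinner (u s) (v s))"
    if "\<And>i. Ck_on 1 ?I (\<lambda>s. u s $ i)" "\<And>i. Ck_on 1 ?I (\<lambda>s. v s $ i)" for u v
    unfolding cinner_def by (intro Ck_on_sum Ck_on_mult Ck_on_cnj that)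
  define \<alpha> where "\<alpha> s = cinner (x s) (dx s) / cinner (x s) (x s)" for s
  have \<alpha>: "Ck_on 1 ?I \<alpha>"
    unfolding \<alpha>_def by (intro Ck_on_divide Ck_cinner x1) (use x'(2) nz in \<open>auto simp: dx_def\<close>)
  \<comment> \<open>Subtracting the projection of \<open>dx\<close> onto the kernel line leaves a
    right-hand side for which \<open>H\<close> can be inverted.\<close>
  define y where "y s = dx s - \<alpha> s *s x s" for s
  have y: "Ck_on 1 ?I (\<lambda>s. y s $ i)" for i
    unfolding y_def using x'(2)[of i]
    by (simp add: dx_def del: Ck_on.simps One_nat_def) (intro Ck_on_diff Ck_on_mult \<alpha> x1)
  have xy: "cinner (x s) (y s) = 0" if "s \<in> ?I" for s
    using nz[OF that] by (simp add: y_def \<alpha>_def cinner_diff_right cinner_smult_right)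
  define M where "M s = (\<chi> i j. H s $ i $ j + x s $ i * cnj (x s $ j))" for s
  have M: "Ck_on 1 ?I (\<lambda>s. M s $ i $ j)" for i j
    unfolding M_def using Ck_on_add[OF H[of i j] Ck_on_mult[OF x1[of i] Ck_on_cnj[OF x1[of j]]]]
    by (simp del: Ck_on.simps One_nat_def)
  have M_mult: "M s *v z = H s *v z + cinner (x s) z *s x s" for s z
    by (simp add: vec_eq_iff M_def matrix_vector_mult_def cinner_def sum_distrib_right
        sum_distrib_left sum.distrib algebra_simps)
  \<comment> \<open>Pairing with \<open>x\<close> removes the \<open>H\<close> part. So whenever
    \<open>M s *v z\<close> is orthogonal to \<open>x s\<close>, so is \<open>z\<close>, and then
    \<open>M\<close> acts on \<open>z\<close> as \<open>H\<close> does. This is used for the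
    invertibility of \<open>M\<close> and again to solve \<open>H g0 = y\<close>.\<close>
  have x_M: "cinner (x s) (M s *v z) = cinner (x s) z * cinner (x s) (x s)" if "s \<in> ?I" for s z
    by (simp add: M_mult cinner_add_right cinner_smult_right cinner_hermitian[OF herm[OF that]] Hx[OF that])
  have det_M: "det (M s) \<noteq> 0" if s: "s \<in> ?I" for s
  proof -
    have "z = 0" if z: "M s *v z = 0" for z
    proof -
      have xz: "cinner (x s) z = 0"
        using x_M[OF s, of z] z nz[OF s] by simp
      then have "z \<in> matrix_kernel (H s)"
        using z by (simp add: M_mult matrix_kernel_def)
      then obtain c where c: "z = c *s x s"
        using ker[OF s] by (auto simp: mem_span_singleton)
      then show "z = 0"
        using xz nz[OF s] by (simp add: cinner_smult_right)
    qed
    then have "invertible (M s)"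
      by (simp add: invertible_left_inverse matrix_left_invertible_ker)
    then show ?thesis
      by (simp add: invertible_det_nz)
  qed
  \<comment> \<open>As a quotient of determinants, the solution visibly inherits the
    differentiability of the entries of \<open>M\<close> and \<open>y\<close>.\<close>
  define g0 where "g0 s = (\<chi> k. det (\<chi> i j. if j = k then y s $ i else M s $ i $ j) / det (M s))" for s
  have g0: "Ck_on 1 ?I (\<lambda>s. g0 s $ k)" for k
  proof -
    have "Ck_on 1 ?I (\<lambda>s. (\<chi> i j. if j = k then y s $ i else M s $ i $ j) $ i $ j)" for i j
      using y M by (cases "j = k") (simp_all del: Ck_on.simps One_nat_def)
    from Ck_on_divide[OF Ck_on_det[OF this] Ck_on_det[OF M] det_M] show ?thesis
      by (simp add: g0_def del: Ck_on.simps One_nat_def)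
  qed
  have Hg0: "H s *v g0 s = y s" if "s \<in> ?I" for s
  proof -
    have Mg0: "M s *v g0 s = y s"
      unfolding cramer[OF det_M[OF that]] g0_def ..
    then have "cinner (x s) (g0 s) = 0"
      using x_M[OF that, of "g0 s"] xy[OF that] nz[OF that] by simp
    then show ?thesis
      using Mg0 by (simp add: M_mult)
  qed
  \<comment> \<open>The gauge factor must satisfy \<open>k' = - \<alpha> k\<close>, for then the
    derivative of \<open>k s *s x s\<close> is \<open>k s *s y s\<close>. The exponential of an
    integral solves this and never vanishes.\<close>
  define \<theta> where "\<theta> u = integral {0..u} \<alpha>" for u
  have deriv_\<theta>: "(\<theta> has_vector_derivative \<alpha> s) (at s within ?I)" if "s \<in> ?I" for s
    unfolding \<theta>_def by (rule integral_has_vector_derivative[OF Ck_on_continuous_on[OF \<alpha>] that])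
  define k where "k = (\<lambda>s. exp (- \<theta> s))"
  have deriv_k: "(k has_vector_derivative - \<alpha> s * k s) (at s within ?I)" if "s \<in> ?I" for s
    using field_vector_diff_chain_within[OF has_vector_derivative_minus[OF deriv_\<theta>[OF that]]
        has_field_derivative_at_within[OF DERIV_exp]]
    by (simp add: k_def o_def)
  have "continuous_on ?I k"
    by (rule continuous_on_vector_derivative[OF deriv_k])
  have k: "Ck_on 1 ?I k"
  proof -
    have "continuous_on ?I (\<lambda>s. - \<alpha> s * k s)"
      by (intro continuous_intros Ck_on_continuous_on[OF \<alpha>] \<open>continuous_on ?I k\<close>)
    then show ?thesis
      unfolding One_nat_def Ck_on.simps
      by (intro exI[of _ "\<lambda>s. - \<alpha> s * k s"] conjI ballI deriv_k)
  qed
  define g where "g s = k s *s g0 s" for s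
  have "\<forall>i. \<exists>f'. (\<forall>s\<in>?I. ((\<lambda>s. g s $ i) has_vector_derivative f' s) (at s within ?I)) \<and> continuous_on ?I f'"
    using Ck_on_mult[OF k g0] by (simp add: g_def)
  then obtain dg where dg: "\<And>i s. s \<in> ?I \<Longrightarrow> ((\<lambda>s. g s $ i) has_vector_derivative dg i s) (at s within ?I)"
    "\<And>i. continuous_on ?I (dg i)"
    by metis
  define g' where "g' s = (\<chi> i. dg i s)" for s
  have deriv_g: "(g has_vector_derivative g' s) (at s within ?I)" if "s \<in> ?I" for s
    using has_vector_derivative_vec_lambda[of "\<lambda>i s. g s $ i" "\<lambda>i. dg i s", OF dg(1)[OF that]]
    by (simp add: g'_def)
  have "((\<lambda>s. k s *s x s) has_vector_derivative H s *v g s) (at s within ?I)" if s: "s \<in> ?I" for s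
  proof -
    have "((\<lambda>s. \<chi> i. k s * x s $ i) has_vector_derivative
        (\<chi> i. k s * x' i s + (- \<alpha> s * k s) * x s $ i)) (at s within ?I)"
      by (intro has_vector_derivative_vec_lambda has_vector_derivative_mult deriv_k x'(1) s)
    moreover have "(\<lambda>s. \<chi> i. k s * x s $ i) = (\<lambda>s. k s *s x s)"
      by (simp add: fun_eq_iff vec_eq_iff)
    moreover have "(\<chi> i. k s * x' i s + (- \<alpha> s * k s) * x s $ i) = k s *s y s"
      by (simp add: vec_eq_iff y_def dx_def algebra_simps)
    moreover have "k s *s y s = H s *v g s"
      by (simp add: g_def vector_scalar_commute Hg0[OF s])
    ultimately show ?thesis
      by simp
  qed
  moreover obtain B1 where "\<forall>s\<in>?I. norm (g s) \<le> B1"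
    using bounded_vec_of_continuous_components[OF continuous_on_vector_derivative[OF dg(1)]] by blast
  moreover obtain B2 where "\<forall>s\<in>?I. norm (g' s) \<le> B2"
    using bounded_vec_of_continuous_components[of 0 T g'] dg(2) by (auto simp: g'_def)
  ultimately show ?thesis
    using deriv_g
    by (intro exI[of _ k] exI[of _ g] exI[of _ g'] exI[of _ "max B1 B2"]) (auto simp: k_def le_max_iff_disj)
qed

text \<open>The zero state sits on \<open>a\<close> at the start and on \<open>b\<close> at the end,
  so the overlap in \<open>adiabatic_estimate\<close> reads off the amplitude of the solution on
  \<open>b\<close>, up to constants of equal modulus and an error of order
  \<open>1 / \<tau>\<close>.\<close>

lemma adiabatic_theorem_zero_state:
  fixes H :: "real \<Rightarrow> complex ^ 'v ^ 'v" and x :: "real \<Rightarrow> complex ^ 'v"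
  assumes pos: "0 < hbar" "0 < T"
    and herm: "\<And>s. s \<in> {0..T} \<Longrightarrow> hermitian (H s)"
    and H: "\<And>i j. Ck_on 1 {0..T} (\<lambda>s. H s $ i $ j)"
    and x: "\<And>i. Ck_on 2 {0..T} (\<lambda>s. x s $ i)"
    and nz: "\<And>s. s \<in> {0..T} \<Longrightarrow> x s \<noteq> 0"
    and ker: "\<And>s. s \<in> {0..T} \<Longrightarrow> matrix_kernel (H s) = vec.span {x s}"
    and start: "x 0 \<in> vec.span {axis a 1}" and "end": "x T \<in> vec.span {axis b 1}"
  shows "adiabatically_transfers hbar T H a b"
proof -
  have T0: "0 \<le> T" using pos by simp
  have "\<exists>k g g' B. \<forall>s\<in>{0..T}. k s \<noteq> 0 \<and>
      ((\<lambda>s. k s *s x s) has_vector_derivative H s *v g s) (at s within {0..T}) \<and>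
      (g has_vector_derivative g' s) (at s within {0..T}) \<and> norm (g s) \<le> B \<and> norm (g' s) \<le> B"
    by (rule adiabatic_frame[OF herm H x nz ker])
  then obtain k g g' B where k: "\<And>s. s \<in> {0..T} \<Longrightarrow> k s \<noteq> 0"
    and e: "\<And>s. s \<in> {0..T} \<Longrightarrow>
      ((\<lambda>s. k s *s x s) has_vector_derivative H s *v g s) (at s within {0..T})"
    and g: "\<And>s. s \<in> {0..T} \<Longrightarrow> (g has_vector_derivative g' s) (at s within {0..T})"
    and B: "\<And>s. s \<in> {0..T} \<Longrightarrow> norm (g s) \<le> B" "\<And>s. s \<in> {0..T} \<Longrightarrow> norm (g' s) \<le> B"
    by blast
  define e where "e s = k s *s x s" for s
  have He: "H s *v e s = 0" if "s \<in> {0..T}" for s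
  proof -
    have "e s \<in> matrix_kernel (H s)"
      using ker[OF that] by (simp add: e_def vec.span_base vec.span_scale)
    then show ?thesis
      by (simp add: matrix_kernel_def)
  qed
  have deriv_e: "(e has_vector_derivative H s *v g s) (at s within {0..T})" if "s \<in> {0..T}" for s
    using e[OF that] by (simp add: e_def[abs_def])
  \<comment> \<open>The gauge does not normalize \<open>e\<close>, but its derivative
    \<open>H g\<close> is orthogonal to \<open>e\<close>, because \<open>H\<close> is Hermitian and
    \<open>H e = 0\<close>; so the norm stays constant.\<close>
  have "norm (cinner (e T) (e T) - cinner (e 0) (e 0)) \<le> 0 * \<bar>T - 0\<bar>"
  proof (rule norm_diff_le_of_vector_derivative)
    show "((\<lambda>s. cinner (e s) (e s)) has_vector_derivative
        cinner (e s) (H s *v g s) + cinner (H s *v g s) (e s)) (at s within {0..T})"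
      if "s \<in> {0..T}" for s
      by (intro has_vector_derivative_cinner deriv_e that)
    show "norm (cinner (e s) (H s *v g s) + cinner (H s *v g s) (e s)) \<le> 0" if "s \<in> {0..T}" for s
      using cinner_hermitian[OF herm[OF that], of "e s" "g s"]
        cinner_hermitian[OF herm[OF that], of "g s" "e s"] He[OF that] by simp
  qed (use T0 in auto)
  then have "(norm (e T))\<^sup>2 = (norm (e 0))\<^sup>2"
    by (simp add: cinner_self flip: of_real_power)
  then have norm_e: "norm (e T) = norm (e 0)"
    by simp
  obtain \<gamma> \<beta> where \<gamma>: "e 0 = axis a \<gamma>" and \<beta>: "e T = axis b \<beta>"
  proof -
    obtain c d where "x 0 = c *s axis a 1" "x T = d *s axis b 1"
      using start "end" by (auto simp: mem_span_singleton)
    then have "e 0 = axis a (k 0 * c)" "e T = axis b (k T * d)"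
      by (auto simp: e_def vec_eq_iff axis_def)
    then show ?thesis
      using that by blast
  qed
  have "e 0 \<noteq> 0"
    using k[of 0] nz[of 0] T0 by (simp add: e_def)
  then have \<gamma>0: "cmod \<gamma> > 0"
    by (auto simp: \<gamma> axis_def vec_eq_iff)
  have \<beta>\<gamma>: "cmod \<beta> = cmod \<gamma>"
    using norm_e by (simp add: \<gamma> \<beta> norm_eq_sqrt_inner inner_axis_axis)
  define C where "C = hbar * T * B * (T + 2) / cmod \<gamma>"
  have estimate: "norm (cmod (\<psi> \<tau> $ b) - 1) \<le> C / \<tau>"
    if sol: "schroedinger_solution hbar T H a \<tau> \<psi>" and "0 < \<tau>" for \<tau> \<psi>
  proof -
    have "cmod (cinner (e T) (\<psi> \<tau>) - cinner (e 0) (\<psi> 0)) \<le> hbar * T * B * (T + 2) / \<tau>"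
      by (rule adiabatic_estimate[OF sol pos \<open>0 < \<tau>\<close> herm He deriv_e g B])
    moreover have "cinner (e T) (\<psi> \<tau>) - cinner (e 0) (\<psi> 0) = cnj \<beta> * \<psi> \<tau> $ b - cnj \<gamma>"
      using sol by (simp add: \<gamma> \<beta> cinner_axis_left schroedinger_solution_def)
    \<comment> \<open>The reverse triangle inequality discards the phases of \<open>\<beta>\<close>
      and \<open>\<gamma>\<close>, about which nothing is claimed.\<close>
    moreover have "\<bar>cmod (cnj \<beta> * \<psi> \<tau> $ b) - cmod (cnj \<gamma>)\<bar> \<le> cmod (cnj \<beta> * \<psi> \<tau> $ b - cnj \<gamma>)"
      by (rule norm_triangle_ineq3)
    ultimately have "\<bar>cmod \<gamma> * cmod (\<psi> \<tau> $ b) - cmod \<gamma>\<bar> \<le> hbar * T * B * (T + 2) / \<tau>"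
      by (simp add: norm_mult \<beta>\<gamma>)
    moreover have "cmod \<gamma> * cmod (\<psi> \<tau> $ b) - cmod \<gamma> = cmod \<gamma> * (cmod (\<psi> \<tau> $ b) - 1)"
      by (simp add: algebra_simps)
    ultimately have "\<bar>cmod (\<psi> \<tau> $ b) - 1\<bar> * cmod \<gamma> \<le> hbar * T * B * (T + 2) / \<tau>"
      by (simp add: abs_mult mult.commute)
    then have "\<bar>cmod (\<psi> \<tau> $ b) - 1\<bar> \<le> hbar * T * B * (T + 2) / \<tau> / cmod \<gamma>"
      using \<gamma>0 by (simp only: pos_le_divide_eq)
    then show ?thesis
      by (simp add: C_def divide_divide_eq_left mult.commute)
  qed
  have "((\<lambda>\<tau>. cmod (\<Psi> \<tau> \<tau> $ b)) \<longlongrightarrow> 1) at_top"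
    if "\<forall>\<tau>>0. schroedinger_solution hbar T H a \<tau> (\<Psi> \<tau>)" for \<Psi>
  proof -
    have "((\<lambda>\<tau>. C / \<tau>) \<longlongrightarrow> 0) at_top"
      by (rule real_tendsto_divide_at_top[OF tendsto_const filterlim_ident])
    moreover have "\<forall>\<^sub>F \<tau> in at_top. norm (cmod (\<Psi> \<tau> \<tau> $ b) - 1) \<le> C / \<tau>"
      using eventually_gt_at_top[of 0] by eventually_elim (use that estimate in blast)
    ultimately have "((\<lambda>\<tau>. cmod (\<Psi> \<tau> \<tau> $ b) - 1) \<longlongrightarrow> 0) at_top"
      by (rule Lim_null_comparison[rotated])
    then show ?thesis
      by (simp add: LIM_zero_iff)
  qed
  moreover have "\<exists>\<psi>. schroedinger_solution hbar T H a \<tau> \<psi>" if "0 < \<tau>" for \<tau>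
    by (rule schroedinger_solution_exists[OF pos(1) T0 that Ck_on_continuous_on[OF H]])
  ultimately show ?thesis
    unfolding adiabatically_transfers_def by blast
qed

section \<open>Semi-bipartite graphs\<close>

lemma control_hamiltonian_eq_scaled_matrix:
  "control_hamiltonian w (commensurate_couplings V1 f) t =
     scaled_matrix (\<lambda>v. if v \<in> V1 then f v t else 1) (adjacency w)"
  by (simp add: vec_eq_iff control_hamiltonian_def commensurate_couplings_def scaled_matrix_def
      adjacency_def)

lemma scaled_zero_state_span_axis:
  assumes "d p = 0" and "scaled_zero_state d \<phi> \<noteq> 0"
  shows "vec.span {scaled_zero_state d \<phi>} = vec.span {axis p 1}"
proof -
  let ?z = "scaled_zero_state d \<phi>"
  have z: "?z = ?z $ p *s axis p 1"
    using scaled_zero_state_at_zero[of d p, OF assms(1)] by (auto simp: vec_eq_iff axis_def)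
  have "?z $ p \<noteq> 0"
  proof
    assume "?z $ p = 0"
    with z have "?z = 0 *s axis p 1"
      by simp
    with assms(2) show False
      by simp
  qed
  then have "vec.span {?z $ p *s axis p 1} = vec.span {axis p 1}"
    by (rule span_singleton_smult)
  then show ?thesis
    using z by simp
qed

text \<open>Reduces the determinant alternative to the eigenvector one. The absence of edges within
  \<open>V1\<close>, together with its larger size, forces a kernel vector; the minors make it
  unique and non-zero on \<open>P\<close>, with \<open>a\<close> witnessing that \<open>P\<close> is
  non-empty.\<close>

lemma semi_bipartite_zero_eigenvector:
  fixes w :: "'v::finite \<Rightarrow> 'v \<Rightarrow> complex"
  assumes "weighted_graph E w" "semi_bipartite E V1 V2" "card V1 = card V2 + 1" "a \<in> P"
    and alt: "(\<forall>p\<in>P. det_delete_vertex w p \<noteq> 0) \<or>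
         (\<exists>\<phi>. \<phi> \<noteq> 0 \<and> adjacency w *v \<phi> = 0 \<and>
              (\<forall>x. adjacency w *v x = 0 \<longrightarrow> (\<exists>c. x = c *s \<phi>)) \<and>
              (\<forall>p\<in>P. \<phi> $ p \<noteq> 0))"
  shows "\<exists>\<phi>. \<phi> \<noteq> 0 \<and> adjacency w *v \<phi> = 0 \<and>
              (\<forall>x. adjacency w *v x = 0 \<longrightarrow> (\<exists>c. x = c *s \<phi>)) \<and>
              (\<forall>p\<in>P. \<phi> $ p \<noteq> 0)"
  using alt
proof
  assume det: "\<forall>p\<in>P. det_delete_vertex w p \<noteq> 0"
  have "- V1 = V2"
    using assms(2) unfolding semi_bipartite_def by blast
  then have "card (- V1) < card V1"
    using assms(3) by simp
  moreover have "adjacency w $ i $ j = 0" if "i \<in> V1" "j \<in> V1" for i j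
  proof -
    have "w i j = 0"
      using assms(1,2) that unfolding weighted_graph_def semi_bipartite_def by blast
    then show ?thesis
      by (simp add: adjacency_def)
  qed
  ultimately obtain x where "x \<noteq> 0" "adjacency w *v x = 0"
    using exists_kernel_vector[of V1 "adjacency w"] by blast
  moreover have "principal_det (UNIV - {p}) (adjacency w) \<noteq> 0" if "p \<in> P" for p
    using det that by (simp add: det_delete_vertex_def)
  ultimately show ?thesis
    using kernel_from_vertex_deleted_det[OF assms(4), of "adjacency w" x] by blast
qed

theorem theorem3:
  fixes E :: "('v::finite \<times> 'v) set"
    and w :: "'v \<Rightarrow> 'v \<Rightarrow> complex"
    and V1 V2 P :: "'v set"
    and f :: "'v \<Rightarrow> real \<Rightarrow> complex"
    and a b :: 'v
    and T hbar :: real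
    and H :: "real \<Rightarrow> complex ^ 'v ^ 'v"
  assumes "weighted_graph E w"
    and "connected_graph E"
    and "semi_bipartite E V1 V2"
    and "P \<subseteq> V1"
    and "card V1 = card V2 + 1"
    and "(\<forall>p\<in>P. det_delete_vertex w p \<noteq> 0) \<or>
         (\<exists>\<phi>. \<phi> \<noteq> 0 \<and> adjacency w *v \<phi> = 0 \<and>
              (\<forall>x. adjacency w *v x = 0 \<longrightarrow> (\<exists>c. x = c *s \<phi>)) \<and>
              (\<forall>p\<in>P. \<phi> $ p \<noteq> 0))"
    and "a \<in> P" and "b \<in> P"
    and "T > 0" and "hbar > 0"
    and "\<And>v. v \<in> V1 \<Longrightarrow> continuous_on {0..T} (f v)"
    and "f a 0 = 0"
    and "f b T = 0"
    and "\<And>v t. v \<in> V1 - P \<Longrightarrow> t \<in> {0..T} \<Longrightarrow> f v t \<noteq> 0"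
    and "\<And>t u v. t \<in> {0..T} \<Longrightarrow> u \<in> V1 \<Longrightarrow> v \<in> V1 \<Longrightarrow> f u t = 0 \<Longrightarrow> f v t = 0 \<Longrightarrow> u = v"
    and H_def: "H = control_hamiltonian w (commensurate_couplings V1 f)"
  shows "(\<forall>t\<in>{0..T}. vec.dim (matrix_kernel (H t)) = 1) \<and>
         continuous_subspace_on {0..T} (\<lambda>t. matrix_kernel (H t)) \<and>
         (\<exists>\<psi>. continuous_on {0..T} \<psi> \<and>
              (\<forall>t\<in>{0..T}. norm (\<psi> t) = 1 \<and> matrix_kernel (H t) = vec.span {\<psi> t})) \<and>
         matrix_kernel (H 0) = vec.span {axis a 1} \<and>
         matrix_kernel (H T) = vec.span {axis b 1} \<and>
         ((\<forall>v\<in>V1. smooth_on {0..T} (f v)) \<longrightarrow> adiabatically_transfers hbar T H a b)"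
proof -
  define d where "d t v = (if v \<in> V1 then f v t else 1)" for t v
  have herm: "hermitian (adjacency w)"
    using assms(1) unfolding weighted_graph_def hermitian_def adjacency_def vec_lambda_beta by blast
  have H: "H t = scaled_matrix (d t) (adjacency w)" for t
    by (simp add: H_def control_hamiltonian_eq_scaled_matrix d_def[abs_def])
  obtain \<phi> where \<phi>: "\<phi> \<noteq> 0" "adjacency w *v \<phi> = 0"
    "\<And>x. adjacency w *v x = 0 \<Longrightarrow> \<exists>c. x = c *s \<phi>" "\<And>p. p \<in> P \<Longrightarrow> \<phi> $ p \<noteq> 0"
    using semi_bipartite_zero_eigenvector[OF assms(1,3,5,7,6)] by blast
  have unique: "u = v" if "t \<in> {0..T}" "d t u = 0" "d t v = 0" for t u v
    using that assms(15)[of t u v] by (auto simp: d_def split: if_splits)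
  \<comment> \<open>A vanishing \<open>d t u\<close> forces \<open>u\<close> into \<open>V1\<close>,
    since \<open>d\<close> is \<open>1\<close> elsewhere, and then into \<open>P\<close>, where
    \<open>\<phi>\<close> is non-zero.\<close>
  have amp: "\<phi> $ u \<noteq> 0" if "t \<in> {0..T}" "d t u = 0" for t u
  proof -
    have "u \<in> V1" "f u t = 0"
      using that(2) by (auto simp: d_def split: if_splits)
    then show ?thesis
      using assms(14)[of u t] that(1) \<phi>(4) by blast
  qed
  define x where "x t = scaled_zero_state (d t) \<phi>" for t
  have nz: "x t \<noteq> 0" if "t \<in> {0..T}" for t
    unfolding x_def by (rule scaled_zero_state_nonzero[OF \<phi>(1) unique[OF that] amp[OF that]])
  have ker: "matrix_kernel (H t) = vec.span {x t}" if "t \<in> {0..T}" for t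
    unfolding H x_def
    by (rule matrix_kernel_scaled_matrix[OF herm \<phi>(1,2,3) unique[OF that] amp[OF that]])
  have d0: "d 0 a = 0" and dT: "d T b = 0"
    using assms(4,7,8,12,13) by (auto simp: d_def)
  have span0: "vec.span {x 0} = vec.span {axis a 1}" and spanT: "vec.span {x T} = vec.span {axis b 1}"
    using scaled_zero_state_span_axis[of "d 0" a, OF d0] scaled_zero_state_span_axis[of "d T" b, OF dT] nz[of 0] nz[of T] assms(9)
    by (simp_all add: x_def)
  have contd: "continuous_on {0..T} (\<lambda>t. d t v)" for v
    using assms(11)[of v] by (cases "v \<in> V1") (simp_all add: d_def)
  have contx: "continuous_on {0..T} x"
    unfolding x_def scaled_zero_state_def by (intro continuous_intros contd)
  \<comment> \<open>Since \<open>x\<close> is continuous and never zero, its normalization is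
    continuous, and with it the projector onto the kernel.\<close>
  define \<psi> where "\<psi> t = x t /\<^sub>R norm (x t)" for t
  have cont: "continuous_on {0..T} \<psi>"
    unfolding \<psi>_def using nz by (intro continuous_intros contx) simp
  have norm: "norm (\<psi> t) = 1" if "t \<in> {0..T}" for t
    using nz[OF that] by (simp add: \<psi>_def)
  have ker': "matrix_kernel (H t) = vec.span {\<psi> t}" if "t \<in> {0..T}" for t
    unfolding ker[OF that] \<psi>_def scaleR_eq_smult
    by (rule span_singleton_smult[symmetric]) (use nz[OF that] in simp)
  have "vec.dim (matrix_kernel (H t)) = 1" if "t \<in> {0..T}" for t
    using nz[OF that] by (simp add: ker[OF that])
  moreover have "continuous_subspace_on {0..T} (\<lambda>t. matrix_kernel (H t))"
    unfolding continuous_subspace_on_def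
  proof
    fix y
    have c: "continuous_on {0..T} (\<lambda>t. \<chi> i. cinner (\<psi> t) y * \<psi> t $ i)"
      unfolding cinner_def by (intro continuous_intros cont)
    have eq: "closest_point (matrix_kernel (H t)) y = (\<chi> i. cinner (\<psi> t) y * \<psi> t $ i)"
      if "t \<in> {0..T}" for t
      by (simp add: ker'[OF that] closest_point_span_singleton[OF norm[OF that]] vec_eq_iff)
    show "continuous_on {0..T} (\<lambda>t. closest_point (matrix_kernel (H t)) y)"
      by (rule continuous_on_eq[OF c eq[symmetric]])
  qed
  moreover have "\<exists>\<psi>. continuous_on {0..T} \<psi> \<and>
      (\<forall>t\<in>{0..T}. norm (\<psi> t) = 1 \<and> matrix_kernel (H t) = vec.span {\<psi> t})"
    using cont norm ker' by blast
  moreover have "matrix_kernel (H 0) = vec.span {axis a 1}" "matrix_kernel (H T) = vec.span {axis b 1}"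
    using ker[of 0] ker[of T] span0 spanT assms(9) by simp_all
  moreover have "adiabatically_transfers hbar T H a b" if smooth: "\<forall>v\<in>V1. smooth_on {0..T} (f v)"
  proof (rule adiabatic_theorem_zero_state[OF assms(10,9) _ _ _ nz ker])
    \<comment> \<open>Both \<open>H\<close> and \<open>x\<close> are polynomial in the controls and
      their conjugates, so every order of differentiability passes to them.\<close>
    have Ck_d: "Ck_on k {0..T} (\<lambda>t. d t v)" for k v
    proof (cases "v \<in> V1")
      case True
      with smooth show ?thesis
        by (simp add: d_def smooth_on_imp_Ck_on)
    next
      case False
      then show ?thesis
        by (simp only: d_def if_False Ck_on_const)
    qed
    show "hermitian (H s)" for s
      unfolding H by (rule hermitian_scaled_matrix[OF herm])
    show "Ck_on 1 {0..T} (\<lambda>s. H s $ i $ j)" for i j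
      unfolding H scaled_matrix_def vec_lambda_beta by (intro Ck_on_mult Ck_on_cnj Ck_d Ck_on_const)
    show "Ck_on 2 {0..T} (\<lambda>s. x s $ i)" for i
      unfolding x_def scaled_zero_state_def vec_lambda_beta
      by (intro Ck_on_mult Ck_on_prod Ck_on_cnj Ck_d Ck_on_const)
    show "x 0 \<in> vec.span {axis a 1}" "x T \<in> vec.span {axis b 1}"
      unfolding span0[symmetric] spanT[symmetric] by (simp_all add: vec.span_base)
  qed
  ultimately show ?thesis
    by blast
qed

end
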